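(* There exists a function $f\in\mathcal{B}$ such that $\dim I(f)=1$.
   Context: A transcendental entire function is an entire function $f:\mathbb{C}\to\mathbb{C}$ that is not a polynomial. The set $\operatorname{sing}(f^{-1})$ consists of the (finite) critical and asymptotic values of $f$. The Eremenko-Lyubich class $\mathcal{B}$ is the set of all transcendental entire functions $f$ for which $\operatorname{sing}(f^{-1})$ is bounded. The escaping set of $f$ is $I(f)=\{z\in\mathbb{C}: f^n(z)\to\infty \text{ as } n\to\infty\}$, where $f^n$ denotes the $n$-th iterate of $f$. The notation $\dim$ denotes Hausdorff dimension (of subsets of $\mathbb{C}$). *)

theory Defs
  imports "HOL-Complex_Analysis.Complex_Analysis"
begin

definition transcendental_entire :: "(complex \<Rightarrow> complex) \<Rightarrow> bool" where
  "transcendental_entire f \<longleftrightarrow> f holomorphic_on UNIV \<and> \<not> (\<exists>p. \<forall>z. f z = poly p z)"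

definition critical_values :: "(complex \<Rightarrow> complex) \<Rightarrow> complex set" where
  "critical_values f = {f z | z. deriv f z = 0}"

definition asymptotic_values :: "(complex \<Rightarrow> complex) \<Rightarrow> complex set" where
  "asymptotic_values f =
     {w. \<exists>\<gamma> :: real \<Rightarrow> complex. continuous_on {0..} \<gamma> \<and> filterlim \<gamma> at_infinity at_top \<and>
           ((\<lambda>t. f (\<gamma> t)) \<longlongrightarrow> w) at_top}"

definition sing_inverse :: "(complex \<Rightarrow> complex) \<Rightarrow> complex set" where
  "sing_inverse f = critical_values f \<union> asymptotic_values f"

definition Eremenko_Lyubich_class :: "(complex \<Rightarrow> complex) set" where
  "Eremenko_Lyubich_class = {f. transcendental_entire f \<and> bounded (sing_inverse f)}"

definition escaping_set :: "(complex \<Rightarrow> complex) \<Rightarrow> complex set" where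
  "escaping_set f = {z. filterlim (\<lambda>n. (f ^^ n) z) at_infinity sequentially}"

(* The term \<open>diam(U)^s\<close> of the Hausdorff sums. For \<open>s = 0\<close> every nonempty set counts 1
   (also a singleton, whereas \<open>0 powr 0 = 0\<close>); the empty set always counts 0. *)
definition hausdorff_gauge :: "real \<Rightarrow> 'a::metric_space set \<Rightarrow> ennreal" where
  "hausdorff_gauge s U = (if s = 0 \<and> U \<noteq> {} then 1 else ennreal (diameter U powr s))"

(* \<open>diameter\<close> is real-valued and meaningless on unbounded sets, so boundedness is required
   explicitly. Finite covers are included, by padding with empty sets. *)
definition delta_covers :: "real \<Rightarrow> 'a::metric_space set \<Rightarrow> (nat \<Rightarrow> 'a set) set" where
  "delta_covers \<delta> A = {U. A \<subseteq> (\<Union>i. U i) \<and> (\<forall>i. bounded (U i) \<and> diameter (U i) \<le> \<delta>)}"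

definition hausdorff_measure :: "real \<Rightarrow> 'a::metric_space set \<Rightarrow> ennreal" where
  "hausdorff_measure s A =
     (SUP \<delta>\<in>{0<..}. INF U\<in>delta_covers \<delta> A. \<Sum>i. hausdorff_gauge s (U i))"

(* The infimum is taken in the extended reals, so it is \<open>\<infinity>\<close> if no such \<open>s\<close> exists. *)
definition hausdorff_dim :: "'a::metric_space set \<Rightarrow> ennreal" where
  "hausdorff_dim A = Inf (ennreal ` {s. 0 \<le> s \<and> hausdorff_measure s A = 0})"

end

theory Submission
  imports Defs "HOL-Probability.Distributions"
begin

text \<open>
  The function is the Cauchy-integral construction of an entire function with a prescribed thin
  tract. On the strips \<open>\<pi>/2 \<le> \<bar>Im z\<bar> \<le> 3\<pi>/2\<close> one has \<open>Re (cosh z) \<le> 0\<close>, so \<open>exp (cosh z)\<close> decays doubly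
  exponentially along every horizontal line in their interior. Hence the Cauchy integral
  \<open>E\<^sub>a(z)\<close> of \<open>exp \<circ> cosh\<close> over the boundary of \<open>{\<bar>Im z\<bar> < a}\<close> converges for \<open>a\<close> strictly between \<open>\<pi>/2\<close>
  and \<open>3\<pi>/2\<close>. Moving the line across the point \<open>z\<close> changes the integral by the residue
  \<open>exp (cosh z)\<close>, so the function which is \<open>exp (cosh z) - E\<^sub>a(z)\<close> inside the strip and \<open>- E\<^sub>a(z)\<close>
  outside continues analytically across the boundary and is entire. Up to a bounded
  error, \<open>f\<close> is therefore \<open>exp (cosh z)\<close> on the strip \<open>\<bar>Im z\<bar> \<le> \<pi>/2\<close> and \<open>0\<close> elsewhere
  (\<open>exp_cosh_tract_exists\<close>). Everything after this uses only these bounds.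

  \<^emph>\<open>Class B.\<close> A critical point with a large value would lie in the strip, where the derivative
  \<open>sinh z * exp (cosh z)\<close> dominates its error. Along a path with a large finite asymptotic value,
  \<open>exp (cosh z)\<close> would stay close to that value; then \<open>cosh z\<close> is trapped near one logarithm of
  it, and \<open>z\<close> cannot tend to infinity.

  \<^emph>\<open>Lower bound.\<close> \<open>f\<close> is real on the real axis and \<open>f x \<ge> x + 1\<close> for large \<open>x\<close>, so a whole ray escapes.

  \<^emph>\<open>Upper bound.\<close> Let \<open>s > 1\<close> and let \<open>X\<close> be the set of points whose orbit stays in \<open>{\<bar>z\<bar> \<ge> R}\<close>. All
  orbits in \<open>X\<close> live in the two half-strips \<open>\<bar>Im z\<bar> \<le> \<pi>/2\<close>, \<open>\<bar>Re z\<bar> \<ge> R - 2\<close>. Cut \<open>X\<close> into pieces according to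
  the side and to the integer \<open>k\<close> nearest to \<open>Im (cosh z) / \<pi>\<close>. The inverse branch of \<open>f\<close> on piece \<open>k\<close> behaves
  like \<open>u \<mapsto> log (log u + \<pi> \<i> k)\<close>, whose derivative is \<open>O(1 / (\<bar>u\<bar> (1 + \<bar>k\<bar>)))\<close>; this is the lemma
  \<open>expansion\<close>. Let \<open>c\<close> be the \<open>s\<close>-dimensional Hausdorff content of \<open>X\<close>. Since \<open>f\<close> maps \<open>X\<close> into \<open>X\<close>,
  summing over the pieces gives \<open>c \<le> const * R powr (- s) * (\<Sum>k. (1 + \<bar>k\<bar>) powr (- s)) * c\<close>, that is
  \<open>c \<le> c / 2\<close> for large \<open>R\<close>. Splitting the image \<open>X\<close> further into unit columns \<open>\<lfloor>Re u\<rfloor> = i\<close> bounds \<open>c\<close> by a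
  multiple of \<open>(\<Sum>k. (1 + \<bar>k\<bar>) powr (- s)) * (\<Sum>i. (1 + \<bar>i\<bar>) powr (- s))\<close>. The columns of the half-strips have
  bounded diameter, and this is where their thinness makes \<open>s > 1\<close> suffice. So \<open>c\<close> is finite, and
  \<open>c \<le> c / 2\<close> forces \<open>c = 0\<close>. Finally, the escaping set is contained in the union of the preimages of \<open>X\<close>
  under the iterates of \<open>f\<close>, and preimages of sets of content zero under a nonconstant entire function have
  content zero.
\<close>

section \<open>Hausdorff content\<close>

text \<open>
  The outer measure obtained from the Hausdorff sums when the mesh of the covers is unrestricted. For \<open>s > 0\<close>
  it vanishes exactly when the Hausdorff measure does, but unlike the latter it is finite on bounded sets,
  which the self-improving inequality \<open>c \<le> c / 2\<close> requires.
\<close>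

definition hausdorff_content :: "real \<Rightarrow> 'a::metric_space set \<Rightarrow> ennreal" where
  "hausdorff_content s A =
     (INF U\<in>{U::nat \<Rightarrow> 'a set. A \<subseteq> (\<Union>i. U i) \<and> (\<forall>i. bounded (U i))}. \<Sum>i. ennreal (diameter (U i) powr s))"

lemma hausdorff_content_le:
  assumes "A \<subseteq> (\<Union>i. U i)" "\<And>i. bounded (U i)"
  shows "hausdorff_content s A \<le> (\<Sum>i. ennreal (diameter (U i) powr s))"
  unfolding hausdorff_content_def by (rule INF_lower) (use assms in auto)

lemma hausdorff_content_cover:
  assumes "hausdorff_content s A < x"
  obtains U where "A \<subseteq> (\<Union>i. U i)" "\<And>i. bounded (U i)" "(\<Sum>i. ennreal (diameter (U i) powr s)) < x"
  using assms unfolding hausdorff_content_def INF_less_iff by blast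

lemma hausdorff_content_mono: "A \<subseteq> B \<Longrightarrow> hausdorff_content s A \<le> hausdorff_content s B"
  unfolding hausdorff_content_def by (rule INF_superset_mono) auto

lemma hausdorff_content_bounded:
  assumes "bounded A"
  shows "hausdorff_content s A \<le> ennreal (diameter A powr s)"
proof -
  have "hausdorff_content s A \<le> (\<Sum>i. ennreal (diameter (if i = 0 then A else {}) powr s))"
    by (rule hausdorff_content_le) (use assms in \<open>auto split: if_splits\<close>)
  also have "\<dots> = (\<Sum>i. if i = 0 then ennreal (diameter A powr s) else 0)"
    by (intro arg_cong[where f=suminf] ext) auto
  also have "\<dots> = ennreal (diameter A powr s)"
    by (subst suminf_finite[of "{0}"]) auto
  finally show ?thesis .
qed

lemma hausdorff_content_singleton [simp]: "hausdorff_content s {x} = 0"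
  using hausdorff_content_bounded[of "{x}" s] by simp

lemma hausdorff_content_UN_le:
  "hausdorff_content s (\<Union>n. A n) \<le> (\<Sum>n::nat. hausdorff_content s (A n))"
proof (rule ennreal_le_epsilon)
  fix e :: real assume e: "0 < e" and top: "(\<Sum>n. hausdorff_content s (A n)) < top"
  have "hausdorff_content s (A n) < top" for n
    using ennreal_suminf_lessD[OF top] .
  then have "hausdorff_content s (A n) < hausdorff_content s (A n) + ennreal (e * (1/2)^Suc n)" for n
    using e by (simp add: less_top)
  then have "\<exists>U. A n \<subseteq> (\<Union>i. U i) \<and> (\<forall>i. bounded (U i)) \<and>
      (\<Sum>i. ennreal (diameter (U i) powr s)) < hausdorff_content s (A n) + ennreal (e * (1/2)^Suc n)" for n
    by (metis hausdorff_content_cover)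
  then obtain U where U: "\<And>n. A n \<subseteq> (\<Union>i. U n i)" "\<And>n i. bounded (U n i)"
      "\<And>n. (\<Sum>i. ennreal (diameter (U n i) powr s)) < hausdorff_content s (A n) + ennreal (e * (1/2)^Suc n)"
    by metis
  have "(\<Union>n. A n) \<subseteq> (\<Union>k. case prod_decode k of (n, i) \<Rightarrow> U n i)"
  proof
    fix x assume "x \<in> (\<Union>n. A n)"
    then obtain n i where "x \<in> U n i" using U(1) by blast
    then show "x \<in> (\<Union>k. case prod_decode k of (n, i) \<Rightarrow> U n i)"
      by (intro UN_I[of "prod_encode (n, i)"]) auto
  qed
  then have "hausdorff_content s (\<Union>n. A n)
      \<le> (\<Sum>k. ennreal (diameter (case prod_decode k of (n, i) \<Rightarrow> U n i) powr s))"
    by (rule hausdorff_content_le) (auto simp: U split: prod.splits)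
  also have "\<dots> = (\<Sum>k. (\<lambda>(n, i). ennreal (diameter (U n i) powr s)) (prod_decode k))"
    by (intro arg_cong[where f=suminf] ext) (auto split: prod.splits)
  also have "\<dots> = (\<Sum>n. \<Sum>i. ennreal (diameter (U n i) powr s))"
    by (rule suminf_ennreal_2dimen) auto
  also have "\<dots> \<le> (\<Sum>n. hausdorff_content s (A n) + ennreal (e * (1/2)^Suc n))"
    using U(3) by (intro suminf_le) (auto intro: less_imp_le)
  also have "\<dots> = (\<Sum>n. hausdorff_content s (A n)) + (\<Sum>n. ennreal (e * (1/2)^Suc n))"
    by (rule suminf_add[symmetric]) auto
  also have "(\<Sum>n. ennreal (e * (1/2)^Suc n)) = ennreal e"
    using sums_mult[OF power_half_series, of e] e by (intro suminf_ennreal_eq) auto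
  finally show "hausdorff_content s (\<Union>n. A n) \<le> (\<Sum>n. hausdorff_content s (A n)) + ennreal e" .
qed

lemma hausdorff_content_Un_le:
  "hausdorff_content s (A \<union> B) \<le> hausdorff_content s A + hausdorff_content s B"
proof -
  have e: "hausdorff_content s {} = (0::ennreal)"
    using hausdorff_content_bounded[of "{}" s] by simp
  have "A \<union> B \<subseteq> (\<Union>n::nat. if n = 0 then A else if n = 1 then B else {})"
    by (auto intro: exI[of _ 0] exI[of _ "Suc 0"])
  then have "hausdorff_content s (A \<union> B) \<le> hausdorff_content s (\<Union>n::nat. if n = 0 then A else if n = 1 then B else {})"
    by (rule hausdorff_content_mono)
  also have "\<dots> \<le> (\<Sum>n::nat. hausdorff_content s (if n = 0 then A else if n = 1 then B else {}))"
    by (rule hausdorff_content_UN_le)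
  also have "\<dots> = hausdorff_content s A + hausdorff_content s B"
    by (subst suminf_finite[of "{0,1}"]) (auto simp: e)
  finally show ?thesis .
qed

lemma hausdorff_content_countable_Union_eq_0:
  assumes "countable I" "\<And>i. i \<in> I \<Longrightarrow> hausdorff_content s (A i) = 0"
  shows "hausdorff_content s (\<Union>i\<in>I. A i) = 0"
proof (cases "I = {}")
  case True
  then show ?thesis using hausdorff_content_bounded[of "{}" s] by simp
next
  case False
  then have "(\<Union>i\<in>I. A i) = (\<Union>n. A (from_nat_into I n))"
    by (metis UN_extend_simps(10) assms(1) range_from_nat_into)
  then show ?thesis
    using hausdorff_content_UN_le[of s "\<lambda>n. A (from_nat_into I n)"] assms(2)[OF from_nat_into[OF False]]
    by simp
qed

text \<open>
  Only an expansion estimate for \<open>g\<close> on \<open>A\<close> is needed, not an inverse branch: the sets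
  \<open>A \<inter> g -` U i\<close> obtained from a cover of the image form a cover of \<open>A\<close>.
\<close>

lemma hausdorff_content_le_expansion:
  fixes g :: "'a::metric_space \<Rightarrow> 'b::metric_space"
  assumes exp: "\<And>z w. z \<in> A \<Longrightarrow> w \<in> A \<Longrightarrow> dist z w \<le> L * dist (g z) (g w)"
    and gAB: "g ` A \<subseteq> B" and L: "0 < L" and s: "0 \<le> s"
  shows "hausdorff_content s A \<le> ennreal (L powr s) * hausdorff_content s B"
proof -
  have *: "hausdorff_content s A \<le> ennreal (L powr s) * x" if x: "hausdorff_content s B < x" for x
  proof -
    obtain U where U: "B \<subseteq> (\<Union>i. U i)" "\<And>i. bounded (U i)" "(\<Sum>i. ennreal (diameter (U i) powr s)) < x"
      using hausdorff_content_cover[OF x] by blast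
    define V where "V i = A \<inter> g -` U i" for i
    have d: "dist z w \<le> L * diameter (U i)" if "z \<in> V i" "w \<in> V i" for z w i
    proof -
      have "dist z w \<le> L * dist (g z) (g w)" using that exp by (auto simp: V_def)
      also have "dist (g z) (g w) \<le> diameter (U i)"
        using that by (intro diameter_bounded_bound U) (auto simp: V_def)
      finally show ?thesis using L by simp
    qed
    have bV: "bounded (V i)" for i
      by (rule bounded_any_center[THEN iffD2, of _ undefined], cases "V i = {}")
        (auto, metis bounded_any_center bounded_def d)
    have dV: "diameter (V i) \<le> L * diameter (U i)" for i
    proof (rule ccontr)
      assume "\<not> ?thesis"
      moreover have "0 \<le> L * diameter (U i)" using L diameter_ge_0[OF U(2)] by simp
      ultimately have "0 < (diameter (V i) + L * diameter (U i)) / 2"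
        "(diameter (V i) + L * diameter (U i)) / 2 < diameter (V i)" by auto
      from diameter_lower_bounded[OF bV this] show False using d[of _ i]
        using \<open>\<not> diameter (V i) \<le> L * diameter (U i)\<close> by fastforce
    qed
    have "A \<subseteq> (\<Union>i. V i)"
    proof
      fix z assume z: "z \<in> A"
      then have "g z \<in> (\<Union>i. U i)" using U(1) gAB by (auto dest!: subsetD)
      then show "z \<in> (\<Union>i. V i)" using z by (auto simp: V_def)
    qed
    then have "hausdorff_content s A \<le> (\<Sum>i. ennreal (diameter (V i) powr s))"
      by (rule hausdorff_content_le) (rule bV)
    also have "\<dots> \<le> (\<Sum>i. ennreal (L powr s) * ennreal (diameter (U i) powr s))"
    proof (intro suminf_le)
      fix i
      have "diameter (V i) powr s \<le> (L * diameter (U i)) powr s"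
        by (intro powr_mono2 s dV diameter_ge_0 bV)
      also have "\<dots> = L powr s * diameter (U i) powr s"
        using L diameter_ge_0[OF U(2)] by (simp add: powr_mult)
      finally show "ennreal (diameter (V i) powr s) \<le> ennreal (L powr s) * ennreal (diameter (U i) powr s)"
        by (simp add: ennreal_mult[symmetric] ennreal_leI)
    qed auto
    also have "\<dots> \<le> ennreal (L powr s) * x"
      using U(3) by (simp add: mult_left_mono less_imp_le)
    finally show ?thesis .
  qed
  show ?thesis
  proof (cases "hausdorff_content s B = top")
    case True
    then show ?thesis using L by (simp add: ennreal_mult_top)
  next
    case False
    show ?thesis
    proof (rule ennreal_le_epsilon)
      fix e :: real assume e: "e > 0"
      have "hausdorff_content s A \<le> ennreal (L powr s) * (hausdorff_content s B + ennreal (e / L powr s))"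
        using False e L by (intro *) (simp add: less_top)
      also have "\<dots> = ennreal (L powr s) * hausdorff_content s B + ennreal e"
        using e L by (simp add: distrib_left ennreal_mult[symmetric])
      finally show "hausdorff_content s A \<le> ennreal (L powr s) * hausdorff_content s B + ennreal e" .
    qed
  qed
qed

text \<open>
  A cover with sum below \<open>\<delta> powr s\<close> automatically has mesh at most \<open>\<delta>\<close>.
\<close>

lemma hausdorff_measure_eq_0_if_content_eq_0:
  assumes 0: "hausdorff_content s A = 0" and s: "0 < s"
  shows "hausdorff_measure s A = 0"
proof -
  have "(INF U\<in>delta_covers \<delta> A. \<Sum>i. hausdorff_gauge s (U i)) = 0" if \<delta>: "\<delta> > 0" for \<delta>
  proof (rule antisym, rule ennreal_le_epsilon)
    fix e :: real assume e: "e > 0"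
    define e' where "e' = min e (\<delta> powr s)"
    have e': "e' > 0" "e' \<le> e" "e' \<le> \<delta> powr s" using e \<delta> by (auto simp: e'_def)
    have "hausdorff_content s A < ennreal e'" using 0 e' by simp
    then obtain U where U: "A \<subseteq> (\<Union>i. U i)" "\<And>i. bounded (U i)"
        "(\<Sum>i. ennreal (diameter (U i) powr s)) < ennreal e'"
      using hausdorff_content_cover by blast
    have "diameter (U i) \<le> \<delta>" for i
    proof (rule ccontr)
      assume "\<not> ?thesis"
      then have "\<delta> powr s < diameter (U i) powr s" using \<delta> s by (intro powr_less_mono2) auto
      moreover have "ennreal (diameter (U i) powr s) < ennreal e'"
        using ennreal_suminf_lessD[OF U(3)] .
      ultimately show False using e' by (simp add: ennreal_less_iff)
    qed
    then have "U \<in> delta_covers \<delta> A" using U by (auto simp: delta_covers_def)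
    then have "(INF U\<in>delta_covers \<delta> A. \<Sum>i. hausdorff_gauge s (U i)) \<le> (\<Sum>i. hausdorff_gauge s (U i))"
      by (rule INF_lower)
    also have "\<dots> = (\<Sum>i. ennreal (diameter (U i) powr s))" using s by (simp add: hausdorff_gauge_def)
    also have "\<dots> \<le> ennreal e" using U(3) e' by (meson ennreal_leI less_imp_le order_trans)
    finally show "(INF U\<in>delta_covers \<delta> A. \<Sum>i. hausdorff_gauge s (U i)) \<le> 0 + ennreal e" by simp
  qed auto
  then show ?thesis unfolding hausdorff_measure_def
    by (metis (no_types, lifting) SUP_least greaterThan_iff le_zero_eq)
qed

lemma hausdorff_dim_le:
  assumes "\<And>s. s > d \<Longrightarrow> hausdorff_content s A = 0" "0 \<le> d"
  shows "hausdorff_dim A \<le> ennreal d"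
proof (rule ennreal_le_epsilon)
  fix e :: real assume "e > 0"
  then have "hausdorff_measure (d + e) A = 0"
    using assms by (intro hausdorff_measure_eq_0_if_content_eq_0) auto
  then have "hausdorff_dim A \<le> ennreal (d + e)"
    unfolding hausdorff_dim_def using \<open>e > 0\<close> assms(2) by (intro Inf_lower) (auto simp del: ennreal_plus)
  then show "hausdorff_dim A \<le> ennreal d + ennreal e"
    using \<open>e > 0\<close> assms(2) by simp
qed

text \<open>
  For \<open>s < 1\<close> and sets of diameter at most 1 the gauge is at least the diameter, and the sum of the
  diameters of a cover controls the Lebesgue measure of its projection to the real axis.
\<close>

lemma hausdorff_dim_ge_1_if_real_segment:
  fixes A :: "complex set"
  assumes "of_real ` {a..a + 1} \<subseteq> A"
  shows "1 \<le> hausdorff_dim A"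
proof -
  have "1 \<le> ennreal s" if s: "0 \<le> s" and 0: "hausdorff_measure s A = 0" for s
  proof (rule ccontr)
    assume "\<not> 1 \<le> ennreal s"
    then have s1: "s < 1" by (simp add: not_le)
    have "(INF U\<in>delta_covers 1 A. \<Sum>i. hausdorff_gauge s (U i)) = 0"
      using 0 unfolding hausdorff_measure_def
      by (metis (no_types, lifting) SUP_upper greaterThan_iff le_zero_eq zero_less_one)
    then have "(INF U\<in>delta_covers 1 A. \<Sum>i. hausdorff_gauge s (U i)) < ennreal (1/2)"
      by (metis ennreal_less_zero_iff half_gt_zero_iff zero_less_one)
    then obtain U where U: "U \<in> delta_covers 1 A" "(\<Sum>i. hausdorff_gauge s (U i)) < ennreal (1/2)"
      unfolding INF_less_iff by blast
    have b: "bounded (U i)" "diameter (U i) \<le> 1" for i using U(1) by (auto simp: delta_covers_def)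
    have gauge: "ennreal (diameter (U i)) \<le> hausdorff_gauge s (U i)" for i
    proof (cases "s = 0 \<and> U i \<noteq> {}")
      case True
      then show ?thesis using b(2)[of i] by (simp add: hausdorff_gauge_def)
    next
      case False
      have "diameter (U i) powr 1 \<le> diameter (U i) powr s"
        using s1 b(2)[of i] diameter_ge_0[OF b(1)[of i]]  by (intro powr_mono') auto
      then have "diameter (U i) \<le> diameter (U i) powr s"
        using diameter_ge_0[OF b(1)[of i]] by simp
      then show ?thesis using False by (auto simp: hausdorff_gauge_def ennreal_leI)
    qed
    \<comment> \<open>The projection of \<open>U i\<close> lies within distance \<open>diameter (U i)\<close> of any of its points.\<close>
    define p where "p i = Re (SOME x. x \<in> U i)" for i
    define V where "V i = {p i - diameter (U i) .. p i + diameter (U i)}" for i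
    have "{a..a+1} \<subseteq> (\<Union>i. V i)"
    proof
      fix x :: real assume "x \<in> {a..a+1}"
      then have "complex_of_real x \<in> A" using assms by blast
      then obtain i where i: "of_real x \<in> U i" using U(1) by (auto simp: delta_covers_def)
      then have "(SOME x. x \<in> U i) \<in> U i" by (rule someI)
      then have "dist (complex_of_real x) (SOME x. x \<in> U i) \<le> diameter (U i)"
        by (intro diameter_bounded_bound b i)
      then have "\<bar>x - p i\<bar> \<le> diameter (U i)"
        using abs_Re_le_cmod[of "complex_of_real x - (SOME x. x \<in> U i)"]
        by (simp add: p_def dist_norm)
      then show "x \<in> (\<Union>i. V i)" by (auto simp: V_def intro!: exI[of _ i])
    qed
    then have "emeasure lborel {a..a+1} \<le> emeasure lborel (\<Union>i. V i)"
      by (intro emeasure_mono) (auto simp: V_def)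
    also have "\<dots> \<le> (\<Sum>i. emeasure lborel (V i))"
      by (intro emeasure_subadditive_countably) (auto simp: V_def)
    also have "\<dots> = (\<Sum>i. 2 * ennreal (diameter (U i)))"
      using diameter_ge_0[OF b(1)]
      by (intro arg_cong[where f=suminf] ext) (simp add: V_def flip: ennreal_numeral ennreal_mult)
    also have "\<dots> \<le> 2 * (\<Sum>i. hausdorff_gauge s (U i))"
      unfolding ennreal_suminf_cmult by (intro mult_left_mono suminf_le gauge) auto
    also have "\<dots> < 2 * ennreal (1/2)"
      using U(2) by (intro ennreal_mult_strict_left_mono) auto
    also have "\<dots> = ennreal (2 * (1/2))"
      by (subst ennreal_mult) auto
    finally show False by simp
  qed
  then show ?thesis unfolding hausdorff_dim_def by (intro Inf_greatest) auto
qed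

section \<open>An entire function with a thin tract\<close>

lemma Re_cosh: "Re (cosh z) = cosh (Re z) * cos (Im z)"
  by (simp add: cosh_conv_cos Re_cos cosh_field_def)

lemma Im_cosh: "Im (cosh z) = sinh (Re z) * sin (Im z)"
  by (simp add: cosh_conv_cos Im_cos sinh_field_def algebra_simps)

lemma cnj_cosh: "cnj (cosh z) = cosh (cnj z)"
  by (simp add: complex_eq_iff Re_cosh Im_cosh)

lemma norm_exp_cosh_le_1:
  assumes "cos (Im z) \<le> 0"
  shows "cmod (exp (cosh z)) \<le> 1"
  using assms by (simp add: Re_cosh mult_nonneg_nonpos)

lemma cosh_real_ge_quadratic: "cosh (x::real) \<ge> 1 + x\<^sup>2 / 4"
proof -
  have "1 + \<bar>x\<bar> + \<bar>x\<bar>\<^sup>2 / 2 \<le> exp \<bar>x\<bar>" by (rule exp_lower_Taylor_quadratic) auto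
  moreover have "1 + (- \<bar>x\<bar>) \<le> exp (- \<bar>x\<bar>)" by (rule exp_ge_add_one_self)
  ultimately have "1 + x\<^sup>2 / 4 \<le> cosh \<bar>x\<bar>" by (simp add: cosh_field_def)
  then show ?thesis by (simp add: abs_if split: if_splits)
qed

lemma continuous_on_Complex_line [continuous_intros]:
  "continuous_on S (\<lambda>v. Complex v a)"
  unfolding Complex_eq by (intro continuous_intros)

text \<open>
  A Gaussian majorant is enough, because \<open>Re (cosh (v + \<i>a)) = cosh v * cos a \<le> - v\<^sup>2 / 8\<close>.
\<close>

lemma integrable_exp_cosh_line:
  assumes "cos a \<le> -1/2"
  shows "integrable lborel (\<lambda>v. exp (cosh (Complex v a)))"
proof (rule Bochner_Integration.integrable_bound)
  show "integrable lborel (\<lambda>v. sqrt (2 * pi * 2\<^sup>2) * normal_density 0 2 v)"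
    by (intro integrable_mult_right integrable_normal_density) auto
  show "(\<lambda>v. exp (cosh (Complex v a))) \<in> borel_measurable lborel"
    unfolding cosh_field_def
    by (simp, intro borel_measurable_continuous_onI continuous_intros) auto
  show "AE v in lborel. norm (exp (cosh (Complex v a))) \<le> norm (sqrt (2 * pi * 2\<^sup>2) * normal_density 0 2 v)"
  proof (intro AE_I2)
    fix v :: real
    have "cosh v * cos a \<le> cosh v * (-1/2)"
      using assms by (intro mult_left_mono) auto
    also have "\<dots> \<le> - v\<^sup>2 / 8" using cosh_real_ge_quadratic[of v] by simp
    finally have "norm (exp (cosh (Complex v a))) \<le> exp (- v\<^sup>2 / 8)"
      by (simp add: Re_cosh)
    also have "\<dots> = norm (sqrt (2 * pi * 2\<^sup>2) * normal_density 0 2 v)"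
      by (simp add: normal_density_def)
    finally show "norm (exp (cosh (Complex v a))) \<le> norm (sqrt (2 * pi * 2\<^sup>2) * normal_density 0 2 v)" .
  qed
qed

definition line_Cauchy :: "real \<Rightarrow> complex \<Rightarrow> complex" where
  "line_Cauchy a z = (LINT v|lborel. exp (cosh (Complex v a)) / (Complex v a - z))"

lemma line_dist_ge: "\<bar>a - Im z\<bar> \<le> cmod (Complex v a - z)"
  using abs_Im_le_cmod[of "Complex v a - z"] by simp

lemma integrable_line_times_bounded:
  fixes g :: "real \<Rightarrow> complex"
  assumes a: "cos a \<le> -1/2" and g: "continuous_on UNIV g" "\<And>v. norm (g v) \<le> B"
  shows "integrable lborel (\<lambda>v. exp (cosh (Complex v a)) * g v)"
    and "norm (LINT v|lborel. exp (cosh (Complex v a)) * g v)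
           \<le> B * (LINT v|lborel. norm (exp (cosh (Complex v a))))"
proof -
  have i: "integrable lborel (\<lambda>v. B * norm (exp (cosh (Complex v a))))"
    by (intro integrable_mult_right integrable_norm integrable_exp_cosh_line a)
  have le: "norm (exp (cosh (Complex v a)) * g v) \<le> B * norm (exp (cosh (Complex v a)))" for v
    using g(2)[of v] by (simp add: norm_mult mult.commute[of B] mult_left_mono)
  show *: "integrable lborel (\<lambda>v. exp (cosh (Complex v a)) * g v)"
  proof (rule Bochner_Integration.integrable_bound[OF i])
    show "(\<lambda>v. exp (cosh (Complex v a)) * g v) \<in> borel_measurable lborel"
      unfolding cosh_field_def
      by (simp, intro borel_measurable_continuous_onI continuous_intros g) auto
  qed (use le order_trans[OF norm_ge_zero g(2)] in \<open>auto simp: norm_mult\<close>)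
  have "norm (LINT v|lborel. exp (cosh (Complex v a)) * g v)
      \<le> (LINT v|lborel. B * norm (exp (cosh (Complex v a))))"
    by (rule Bochner_Integration.integral_norm_bound_integral[OF * i le])
  then show "norm (LINT v|lborel. exp (cosh (Complex v a)) * g v)
           \<le> B * (LINT v|lborel. norm (exp (cosh (Complex v a))))" by simp
qed

lemma
  assumes a: "cos a \<le> -1/2" and z: "0 < d" "d \<le> \<bar>a - Im z\<bar>"
  shows integrable_line_Cauchy: "integrable lborel (\<lambda>v. exp (cosh (Complex v a)) / (Complex v a - z))"
    and norm_line_Cauchy_le: "cmod (line_Cauchy a z) \<le> (LINT v|lborel. norm (exp (cosh (Complex v a)))) / d"
proof -
  have c: "continuous_on UNIV (\<lambda>v. 1 / (Complex v a - z))"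
    using z by (intro continuous_intros) (auto simp: complex_eq_iff)
  have b: "norm (1 / (Complex v a - z)) \<le> 1 / d" for v
  proof -
    have "d \<le> cmod (Complex v a - z)" using line_dist_ge[of a z v] z by simp
    then show ?thesis using z(1) by (simp add: norm_divide frac_le)
  qed
  show "integrable lborel (\<lambda>v. exp (cosh (Complex v a)) / (Complex v a - z))"
    using integrable_line_times_bounded(1)[OF a c b] by simp
  show "cmod (line_Cauchy a z) \<le> (LINT v|lborel. norm (exp (cosh (Complex v a)))) / d"
    using integrable_line_times_bounded(2)[OF a c b] by (simp add: line_Cauchy_def)
qed

text \<open>
  Differentiation under the integral sign: with \<open>T = v + \<i>a - z\<close>, the identity
  \<open>(1 / (T - h) - 1 / T) / h - 1 / T\<^sup>2 = h / ((T - h) * T\<^sup>2)\<close> bounds the error of the difference quotient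
  by a multiple of \<open>\<bar>h\<bar>\<close>, uniformly in \<open>v\<close>.
\<close>

lemma holomorphic_line_Cauchy:
  assumes a: "cos a \<le> -1/2"
  shows "line_Cauchy a holomorphic_on {z. Im z \<noteq> a}"
proof -
  have "line_Cauchy a field_differentiable at z" if z: "Im z \<noteq> a" for z
  proof -
    define d where "d = \<bar>a - Im z\<bar>"
    have d: "d > 0" using z by (simp add: d_def)
    let ?p = "\<lambda>v. exp (cosh (Complex v a))"
    define M where "M = (LINT v|lborel. norm (?p v))"
    define D where "D = (LINT v|lborel. ?p v * (1 / (Complex v a - z)\<^sup>2))"
    have dist: "d \<le> cmod (Complex v a - z)" for v using line_dist_ge[of a z v] by (simp add: d_def)
    then have ne: "Complex v a - z \<noteq> 0" for v using d by (metis norm_zero not_le)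
    have cont2: "continuous_on UNIV (\<lambda>v. 1 / (Complex v a - z)\<^sup>2)"
      using ne by (intro continuous_intros) auto
    have bd2: "norm (1 / (Complex v a - z)\<^sup>2) \<le> 1 / d\<^sup>2" for v
      using dist[of v] d by (simp add: norm_divide norm_power frac_le power_mono)
    have est: "norm ((line_Cauchy a (z + h) - line_Cauchy a z) / h - D) \<le> (2 / d ^ 3 * M) * norm h"
      if h: "h \<noteq> 0" "norm h < d / 2" for h
    proof -
      have "\<bar>Im h\<bar> < d / 2" using h abs_Im_le_cmod[of h] by simp
      then have imh: "d / 2 \<le> \<bar>a - Im (z + h)\<bar>" unfolding d_def plus_complex.simps by argo
      then have disth: "d / 2 \<le> cmod (Complex v a - (z + h))" for v
        using line_dist_ge[of a "z+h" v] by linarith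
      have neh: "Complex v a - (z + h) \<noteq> 0" for v
        using disth[of v] d by auto
      have conth: "continuous_on UNIV (\<lambda>v. 1 / ((Complex v a - (z + h)) * (Complex v a - z)\<^sup>2))"
        using ne neh by (intro continuous_intros) auto
      have bdh: "norm (1 / ((Complex v a - (z + h)) * (Complex v a - z)\<^sup>2)) \<le> 2 / d ^ 3" for v
      proof -
        have "d / 2 * d\<^sup>2 \<le> cmod (Complex v a - (z + h)) * (cmod (Complex v a - z))\<^sup>2"
          using disth[of v] dist[of v] d by (intro mult_mono power_mono) auto
        then have "1 / (cmod (Complex v a - (z + h)) * (cmod (Complex v a - z))\<^sup>2) \<le> 1 / (d / 2 * d\<^sup>2)"
          using d by (intro frac_le) auto
        then show ?thesis by (simp add: norm_divide norm_mult norm_power power3_eq_cube power2_eq_square mult_ac)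
      qed
      have key: "(?p v / (Complex v a - (z + h)) - ?p v / (Complex v a - z)) / h - ?p v * (1 / (Complex v a - z)\<^sup>2)
         = h * (?p v * (1 / ((Complex v a - (z + h)) * (Complex v a - z)\<^sup>2)))" for v
      proof -
        have "(p / (T - h) - p / T) / h - p * (1 / T\<^sup>2) = h * (p * (1 / ((T - h) * T\<^sup>2)))"
          if "T \<noteq> 0" "T - h \<noteq> 0" for T p
          using that h by (simp add: divide_simps) (simp add: algebra_simps power2_eq_square)
        from this[of "Complex v a - z" "?p v"] ne[of v] neh[of v] show ?thesis
          by (simp add: algebra_simps)
      qed
      have i1: "integrable lborel (\<lambda>v. ?p v / (Complex v a - (z + h)))"
        using imh d by (intro integrable_line_Cauchy[OF a, of "d/2"]) auto
      have i2: "integrable lborel (\<lambda>v. ?p v / (Complex v a - z))"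
        using d by (intro integrable_line_Cauchy[OF a, of d]) (auto simp: d_def)
      have "(line_Cauchy a (z + h) - line_Cauchy a z) / h - D
          = (LINT v|lborel. (?p v / (Complex v a - (z + h)) - ?p v / (Complex v a - z)) / h
                - ?p v * (1 / (Complex v a - z)\<^sup>2))"
        unfolding line_Cauchy_def D_def
        using i1 i2 integrable_line_times_bounded(1)[OF a cont2 bd2] by simp
      also have "\<dots> = h * (LINT v|lborel. ?p v * (1 / ((Complex v a - (z + h)) * (Complex v a - z)\<^sup>2)))"
        unfolding key by (rule integral_mult_right_zero)
      finally have "norm ((line_Cauchy a (z + h) - line_Cauchy a z) / h - D)
         = norm h * norm (LINT v|lborel. ?p v * (1 / ((Complex v a - (z + h)) * (Complex v a - z)\<^sup>2)))"
        by (simp only: norm_mult)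
      also have "\<dots> \<le> norm h * (2 / d ^ 3 * M)"
        unfolding M_def by (intro mult_left_mono integrable_line_times_bounded(2)[OF a conth bdh]) auto
      finally show ?thesis by (simp add: mult.commute)
    qed
    have "((\<lambda>h. (line_Cauchy a (z + h) - line_Cauchy a z) / h - D) \<longlongrightarrow> 0) (at 0)"
    proof (rule Lim_null_comparison)
      show "\<forall>\<^sub>F h in at 0. norm ((line_Cauchy a (z + h) - line_Cauchy a z) / h - D) \<le> (2 / d ^ 3 * M) * norm h"
        unfolding eventually_at
        by (intro exI[of _ "d / 2"] conjI ballI impI est) (use d in auto)
      show "((\<lambda>h::complex. (2 / d ^ 3 * M) * norm h) \<longlongrightarrow> 0) (at 0)"
        by (intro tendsto_mult_right_zero tendsto_norm_zero tendsto_ident_at)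
    qed
    then have "(line_Cauchy a has_field_derivative D) (at z)"
      unfolding DERIV_def by (rule LIM_zero_cancel)
    then show ?thesis by (auto simp: field_differentiable_def)
  qed
  then show ?thesis
    by (auto simp: holomorphic_on_def intro: field_differentiable_at_within)
qed

lemma contour_integral_linepath_same_Im:
  assumes "A < B"
  shows "contour_integral (linepath (Complex A a) (Complex B a)) g = integral {A..B} (\<lambda>v. g (Complex v a))"
proof -
  have "linepath (Complex A a) (Complex B a) x = linepath (of_real A) (of_real B) x + Complex 0 a" for x
    by (simp add: complex_eq_iff linepath_def algebra_simps)
  then have "contour_integral (linepath (Complex A a) (Complex B a)) g
      = contour_integral (linepath (of_real A) (of_real B)) (\<lambda>w. g (w + Complex 0 a))"
    unfolding contour_integral_integral by (simp add: Complex_eq algebra_simps)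
  also have "\<dots> = integral {A..B} (\<lambda>v. g (of_real v + Complex 0 a))"
    using assms by (subst contour_integral_linepath_Reals_eq) auto
  finally show ?thesis by (simp add: Complex_eq)
qed

text \<open>
  Cauchy's formula on the rectangles \<open>[- n, n] \<times> [c, d]\<close>. The vertical sides disappear in the limit,
  since on them \<open>exp \<circ> cosh\<close> is bounded by 1 and the kernel is \<open>O(1 / n)\<close>.
\<close>

lemma line_Cauchy_shift:
  assumes cd: "c < d" and neg: "\<And>y. c \<le> y \<Longrightarrow> y \<le> d \<Longrightarrow> cos y \<le> 0"
    and c: "cos c \<le> -1/2" and d: "cos d \<le> -1/2" and z: "Im z \<noteq> c" "Im z \<noteq> d"
  shows "line_Cauchy c z - line_Cauchy d z
           = (if c < Im z \<and> Im z < d then 2 * pi * \<i> * exp (cosh z) else 0)" (is "_ = ?J")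
proof -
  define g where "g w = exp (cosh w) / (w - z)" for w
  define H where "H a n = integral {-real n..real n} (\<lambda>v. g (Complex v a))" for a n
  define V where "V x = contour_integral (linepath (Complex x c) (Complex x d)) g" for x
  have contg: "continuous_on S g" if "z \<notin> S" for S
    unfolding g_def cosh_field_def using that by (intro continuous_intros) auto
  have H_lim: "H a \<longlonglongrightarrow> line_Cauchy a z" if a: "cos a \<le> -1/2" "Im z \<noteq> a" for a
  proof -
    have int: "integrable lborel (\<lambda>v. g (Complex v a))"
      unfolding g_def using a by (intro integrable_line_Cauchy[of a "\<bar>a - Im z\<bar>"]) auto
    have "H a = (\<lambda>n. LINT v|lborel. indicator {-real n..real n} v *\<^sub>R g (Complex v a))"
    proof
      fix n
      have "set_integrable lborel {-real n..real n} (\<lambda>v. g (Complex v a))"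
        using int unfolding set_integrable_def by (intro integrable_mult_indicator) auto
      from set_borel_integral_eq_integral(2)[OF this]
      show "H a n = (LINT v|lborel. indicator {-real n..real n} v *\<^sub>R g (Complex v a))"
        by (simp add: H_def set_lebesgue_integral_def)
    qed
    moreover have "(\<lambda>n. LINT v|lborel. indicator {-real n..real n} v *\<^sub>R g (Complex v a)) \<longlonglongrightarrow> (LINT v|lborel. g (Complex v a))"
    proof (rule integral_dominated_convergence[where w="\<lambda>v. norm (g (Complex v a))"])
      show "AE v in lborel. (\<lambda>n. indicator {-real n..real n} v *\<^sub>R g (Complex v a)) \<longlonglongrightarrow> g (Complex v a)"
      proof (intro AE_I2 tendsto_eventually)
        fix v :: real
        have "\<forall>\<^sub>F n in sequentially. \<bar>v\<bar> \<le> real n"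
          using filterlim_real_sequentially unfolding filterlim_at_top by blast
        then show "\<forall>\<^sub>F n in sequentially. indicator {-real n..real n} v *\<^sub>R g (Complex v a) = g (Complex v a)"
          by eventually_elim (auto simp: indicator_def abs_le_iff)
      qed
    qed (use int in \<open>auto split: split_indicator intro: borel_measurable_integrable\<close>)
    ultimately show ?thesis by (simp add: line_Cauchy_def g_def)
  qed
  have V_bound: "norm (V x) \<le> 1 / \<bar>x - Re z\<bar> * (d - c)" if "x \<noteq> Re z" for x
  proof -
    have "norm (V x) \<le> 1 / \<bar>x - Re z\<bar> * norm (Complex x d - Complex x c)" unfolding V_def
    proof (rule contour_integral_bound_linepath)
      show "g contour_integrable_on linepath (Complex x c) (Complex x d)"
        by (intro contour_integrable_continuous_linepath contg)
          (use that cd in \<open>auto simp: closed_segment_same_Re\<close>)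
      fix w assume "w \<in> closed_segment (Complex x c) (Complex x d)"
      then have w: "Re w = x" "c \<le> Im w" "Im w \<le> d"
        using cd by (auto simp: closed_segment_same_Re closed_segment_eq_real_ivl)
      have "\<bar>x - Re z\<bar> \<le> cmod (w - z)" using w abs_Re_le_cmod[of "w - z"] by simp
      then show "cmod (g w) \<le> 1 / \<bar>x - Re z\<bar>"
        unfolding g_def norm_divide using norm_exp_cosh_le_1[of w] neg w that
        by (intro frac_le) auto
    qed auto
    also have "norm (Complex x d - Complex x c) = d - c"
      using cd by (simp add: cmod_def)
    finally show ?thesis .
  qed
  have V_lim: "(\<lambda>n. V (\<sigma> * real n)) \<longlonglongrightarrow> 0" if \<sigma>: "\<sigma> \<in> {-1, 1}" for \<sigma>
  proof (rule Lim_null_comparison)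
    have "\<forall>\<^sub>F n in sequentially. \<bar>Re z\<bar> + 1 \<le> real n"
      using filterlim_real_sequentially unfolding filterlim_at_top by blast
    then show "\<forall>\<^sub>F n in sequentially. norm (V (\<sigma> * real n)) \<le> 1 / \<bar>\<sigma> * real n - Re z\<bar> * (d - c)"
      by eventually_elim (rule V_bound, use \<sigma> in auto)
    show "(\<lambda>n. 1 / \<bar>\<sigma> * real n - Re z\<bar> * (d - c)) \<longlonglongrightarrow> 0"
      using \<sigma> by (elim insertE) (simp, real_asymp, simp, real_asymp, simp)
  qed
  have rect: "\<forall>\<^sub>F n in sequentially. H c n - H d n + (V (real n) - V (- real n)) = ?J"
  proof -
    have "\<forall>\<^sub>F n in sequentially. \<bar>Re z\<bar> + 1 \<le> real n"
      using filterlim_real_sequentially unfolding filterlim_at_top by blast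
    then show ?thesis
    proof eventually_elim
      fix n assume n: "\<bar>Re z\<bar> + 1 \<le> real n"
      let ?a = "Complex (- real n) c" and ?b = "Complex (real n) d"
      have img: "z \<notin> path_image (rectpath ?a ?b)"
        using n cd z by (subst path_image_rectpath) auto
      have wn: "winding_number (rectpath ?a ?b) z = (if c < Im z \<and> Im z < d then 1 else 0)"
      proof (cases "c < Im z \<and> Im z < d")
        case True
        then show ?thesis using n by (simp, intro winding_number_rectpath) (auto simp: in_box_complex_iff)
      next
        case False
        then have "z \<notin> cbox ?a ?b" using z by (auto simp: in_cbox_complex_iff)
        then show ?thesis using False cd
          by (simp only: if_False, intro winding_number_rectpath_outside) auto
      qed
      have "((\<lambda>w. exp (cosh w) / (w - z)) has_contour_integral
              (2 * pi * \<i> * winding_number (rectpath ?a ?b) z * exp (cosh z))) (rectpath ?a ?b)"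
        using img by (intro Cauchy_integral_formula_convex_simple[of UNIV])
          (auto intro!: holomorphic_intros simp: cosh_field_def)
      then have total: "(g has_contour_integral ?J) (rectpath ?a ?b)"
        unfolding wn by (auto simp: g_def[abs_def] split: if_splits)
      have sides: "(g has_contour_integral
          contour_integral (linepath ?a (Complex (real n) c)) g
          + (contour_integral (linepath (Complex (real n) c) ?b) g
          + (contour_integral (linepath ?b (Complex (- real n) d)) g
          + contour_integral (linepath (Complex (- real n) d) ?a) g))) (rectpath ?a ?b)"
      proof -
        have "continuous_on (path_image (rectpath ?a ?b)) g" using img by (rule contg)
        then have "continuous_on (closed_segment ?a (Complex (real n) c)) g"
           "continuous_on (closed_segment (Complex (real n) c) ?b) g"
           "continuous_on (closed_segment ?b (Complex (- real n) d)) g"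
           "continuous_on (closed_segment (Complex (- real n) d) ?a) g"
          by (auto simp: rectpath_def Let_def path_image_join elim: continuous_on_subset)
        then show ?thesis unfolding rectpath_def Let_def
          by (auto intro!: has_contour_integral_join has_contour_integral_integral
              contour_integrable_continuous_linepath)
      qed
      have top: "contour_integral (linepath ?b (Complex (- real n) d)) g = - H d n"
        using n z by (subst contour_integral_reverse_linepath)
          (auto simp: H_def contour_integral_linepath_same_Im closed_segment_same_Im
             closed_segment_eq_real_ivl intro!: contg)
      have left: "contour_integral (linepath (Complex (- real n) d) ?a) g = - V (- real n)"
        using n cd z by (subst contour_integral_reverse_linepath)
          (auto simp: V_def closed_segment_same_Re
             closed_segment_eq_real_ivl intro!: contg)
      have bottom: "contour_integral (linepath ?a (Complex (real n) c)) g = H c n"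
        using n by (simp add: H_def contour_integral_linepath_same_Im)
      have "?J = H c n + (V (real n) + (- H d n + - V (- real n)))"
        using has_contour_integral_unique[OF total sides] unfolding top left bottom V_def by simp
      then show "H c n - H d n + (V (real n) - V (- real n)) = ?J" by simp
    qed
  qed
  have "(\<lambda>n. H c n - H d n + (V (real n) - V (- real n))) \<longlonglongrightarrow> line_Cauchy c z - line_Cauchy d z + (0 - 0)"
    using V_lim[of 1] V_lim[of "-1"] z c d by (intro tendsto_intros H_lim) auto
  moreover have "(\<lambda>n. H c n - H d n + (V (real n) - V (- real n))) \<longlonglongrightarrow> ?J"
    using rect by (rule tendsto_eventually)
  ultimately show ?thesis using LIMSEQ_unique by fastforce
qed


text \<open>
  The Cauchy integral of \<open>exp \<circ> cosh\<close> over the positively oriented boundary of the strip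
  \<open>{\<bar>Im z\<bar> < a}\<close>.
\<close>

definition strip_Cauchy :: "real \<Rightarrow> complex \<Rightarrow> complex" where
  "strip_Cauchy a z = (line_Cauchy (- a) z - line_Cauchy a z) / (2 * pi * \<i>)"

lemma cos_le_0_obtuse:
  assumes "pi / 2 \<le> \<bar>y\<bar>" "\<bar>y\<bar> \<le> pi"
  shows "cos y \<le> 0"
proof -
  have "cos \<bar>y\<bar> \<le> cos (pi / 2)"
    using assms by (intro cos_monotone_0_pi_le) auto
  then show ?thesis by simp
qed

text \<open>
  Exactly one of the two boundary lines is moved across \<open>z\<close>; it contributes the residue, and
  the other line contributes nothing.
\<close>

lemma strip_Cauchy_jump:
  assumes "2 * pi / 3 < \<bar>Im z\<bar>" "\<bar>Im z\<bar> < pi"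
  shows "strip_Cauchy pi z - strip_Cauchy (2 * pi / 3) z = exp (cosh z)"
proof -
  have c: "cos (2 * pi / 3) \<le> - 1 / 2" "cos (- (2 * pi / 3)) \<le> - 1 / 2"
    using cos_120 by auto
  have up: "line_Cauchy (2 * pi / 3) z - line_Cauchy pi z
      = (if 2 * pi / 3 < Im z \<and> Im z < pi then 2 * pi * \<i> * exp (cosh z) else 0)"
    using assms c by (intro line_Cauchy_shift cos_le_0_obtuse) auto
  have low: "line_Cauchy (- pi) z - line_Cauchy (- (2 * pi / 3)) z
      = (if - pi < Im z \<and> Im z < - (2 * pi / 3) then 2 * pi * \<i> * exp (cosh z) else 0)"
    using assms c by (intro line_Cauchy_shift cos_le_0_obtuse) auto
  have "strip_Cauchy pi z - strip_Cauchy (2 * pi / 3) z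
      = ((line_Cauchy (- pi) z - line_Cauchy (- (2 * pi / 3)) z)
          + (line_Cauchy (2 * pi / 3) z - line_Cauchy pi z)) / (2 * pi * \<i>)"
    unfolding strip_Cauchy_def by (simp add: divide_simps)
  also have "\<dots> = (2 * pi * \<i> * exp (cosh z)) / (2 * pi * \<i>)"
    unfolding up low using assms by (cases "Im z > 0") auto
  finally show ?thesis by simp
qed

lemma holomorphic_strip_Cauchy:
  assumes "cos a \<le> -1/2" "S \<subseteq> {z. \<bar>Im z\<bar> \<noteq> \<bar>a\<bar>}"
  shows "strip_Cauchy a holomorphic_on S"
proof -
  have "S \<subseteq> {z. Im z \<noteq> a}" "S \<subseteq> {z. Im z \<noteq> - a}" using assms(2) by auto
  then have "line_Cauchy a holomorphic_on S" "line_Cauchy (- a) holomorphic_on S"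
    using assms(1) by (auto intro: holomorphic_on_subset[OF holomorphic_line_Cauchy])
  then show ?thesis unfolding strip_Cauchy_def[abs_def] by (intro holomorphic_intros) auto
qed

lemma strip_Cauchy_bounded:
  assumes "cos a \<le> -1/2" "0 < d"
  obtains M where "\<And>z. d \<le> \<bar>\<bar>Im z\<bar> - \<bar>a\<bar>\<bar> \<Longrightarrow> cmod (strip_Cauchy a z) \<le> M"
proof
  let ?M = "\<lambda>a. (LINT v|lborel. norm (exp (cosh (Complex v a)))) / d"
  fix z assume z: "d \<le> \<bar>\<bar>Im z\<bar> - \<bar>a\<bar>\<bar>"
  have "cmod (line_Cauchy (- a) z - line_Cauchy a z) \<le> ?M (- a) + ?M a"
    by (rule order_trans[OF norm_triangle_ineq4 add_mono]; rule norm_line_Cauchy_le)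
      (use assms z in auto)
  then show "cmod (strip_Cauchy a z) \<le> (?M (- a) + ?M a) / (2 * pi)"
    unfolding strip_Cauchy_def norm_divide norm_mult by (simp add: divide_right_mono)
qed

lemma strip_Cauchy_cnj: "strip_Cauchy a (cnj z) = cnj (strip_Cauchy a z)"
proof -
  have "line_Cauchy (- b) (cnj z) = cnj (line_Cauchy b z)" for b
  proof -
    have [simp]: "cnj (Complex v b) = Complex v (- b)" for v by (simp add: complex_eq_iff)
    have "cnj (line_Cauchy b z) = (LINT v|lborel. cnj (exp (cosh (Complex v b)) / (Complex v b - z)))"
      unfolding line_Cauchy_def by (rule Bochner_Integration.integral_cnj[symmetric])
    also have "\<dots> = line_Cauchy (- b) (cnj z)"
      unfolding line_Cauchy_def
      by (intro Bochner_Integration.integral_cong refl)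
        (simp add: cnj_cosh exp_cnj)
    finally show ?thesis ..
  qed
  from this[of a] this[of "- a"] show ?thesis
    by (simp add: strip_Cauchy_def divide_simps)
qed

text \<open>
  What the dynamical part of the argument needs to know about the function. The constant \<open>C\<close> also
  bounds the derivative of the error; this makes the error Lipschitz, so that it does not spoil the
  expansion of \<open>exp \<circ> cosh\<close>.
\<close>

locale exp_cosh_tract =
  fixes f :: "complex \<Rightarrow> complex" and C :: real
  assumes holo: "f holomorphic_on UNIV"
    and C_ge_1: "1 \<le> C"
    and outside: "\<And>z. pi / 2 \<le> \<bar>Im z\<bar> \<Longrightarrow> cmod (f z) \<le> C"
    and inside: "\<And>z. \<bar>Im z\<bar> \<le> pi / 2 \<Longrightarrow> cmod (f z - exp (cosh z)) \<le> C"
    and inside_deriv: "\<And>z. \<bar>Im z\<bar> \<le> pi / 2 \<Longrightarrow> cmod (deriv f z - sinh z * exp (cosh z)) \<le> C"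
    and real: "\<And>x. x \<in> \<real> \<Longrightarrow> f x \<in> \<real>"

text \<open>
  Two contours are used so that every point is at distance at least \<open>\<pi>/6\<close> from the contour of one
  of the two formulas valid there: for \<open>\<bar>Im z\<bar> \<le> 5\<pi>/6\<close> the lines \<open>\<bar>Im z\<bar> = \<pi>\<close>, and for \<open>\<bar>Im z\<bar> \<ge> 5\<pi>/6\<close> the
  lines \<open>\<bar>Im z\<bar> = 2\<pi>/3\<close>.
\<close>

lemma exp_cosh_tract_exists: "\<exists>f C. exp_cosh_tract f C"
proof -
  define f where "f z = (if \<bar>Im z\<bar> < pi then exp (cosh z) - strip_Cauchy pi z
      else - strip_Cauchy (2 * pi / 3) z)" for z
  have cos: "cos pi \<le> - 1 / 2" "cos (2 * pi / 3) \<le> - 1 / 2" using cos_120 by auto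
  have f_in: "f z = exp (cosh z) - strip_Cauchy pi z" if "\<bar>Im z\<bar> < pi" for z
    using that by (simp add: f_def)
  have f_out: "f z = - strip_Cauchy (2 * pi / 3) z" if "2 * pi / 3 < \<bar>Im z\<bar>" for z
    using strip_Cauchy_jump[OF that] by (auto simp: f_def algebra_simps)
  have open_in: "open {z. \<bar>Im z\<bar> < pi}" and open_out: "open {z. 2 * pi / 3 < \<bar>Im z\<bar>}"
    by (intro open_Collect_less continuous_intros)+
  have holo_in: "f holomorphic_on {z. \<bar>Im z\<bar> < pi}"
  proof (rule holomorphic_transform)
    show "(\<lambda>z. exp (cosh z) - strip_Cauchy pi z) holomorphic_on {z. \<bar>Im z\<bar> < pi}"
      unfolding cosh_field_def
      by (intro holomorphic_intros holomorphic_strip_Cauchy cos) auto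
  qed (simp add: f_in)
  have holo_out: "f holomorphic_on {z. 2 * pi / 3 < \<bar>Im z\<bar>}"
  proof (rule holomorphic_transform)
    show "(\<lambda>z. - strip_Cauchy (2 * pi / 3) z) holomorphic_on {z. 2 * pi / 3 < \<bar>Im z\<bar>}"
      by (intro holomorphic_intros holomorphic_strip_Cauchy cos) auto
  qed (simp add: f_out)
  have "\<bar>Im z\<bar> < pi \<or> 2 * pi / 3 < \<bar>Im z\<bar>" for z
    using pi_gt_zero by linarith
  then have "{z. \<bar>Im z\<bar> < pi} \<union> {z. 2 * pi / 3 < \<bar>Im z\<bar>} = UNIV" by blast
  with holomorphic_on_Un[OF holo_in holo_out open_in open_out]
  have holo: "f holomorphic_on UNIV" by simp
  obtain M1 where M1: "\<And>z. pi / 6 \<le> \<bar>\<bar>Im z\<bar> - \<bar>pi\<bar>\<bar> \<Longrightarrow> cmod (strip_Cauchy pi z) \<le> M1"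
    using strip_Cauchy_bounded[OF cos(1), of "pi/6"] by auto
  obtain M2 where M2: "\<And>z. pi / 6 \<le> \<bar>\<bar>Im z\<bar> - \<bar>2 * pi / 3\<bar>\<bar> \<Longrightarrow> cmod (strip_Cauchy (2 * pi / 3) z) \<le> M2"
    using strip_Cauchy_bounded[OF cos(2), of "pi/6"] by auto
  have near: "cmod (strip_Cauchy pi z) \<le> \<bar>M1\<bar>" if "\<bar>Im z\<bar> \<le> 5 * pi / 6" for z
    using M1[of z] that by force
  have far: "cmod (strip_Cauchy (2 * pi / 3) z) \<le> \<bar>M2\<bar>" if "5 * pi / 6 \<le> \<bar>Im z\<bar>" for z
    using M2[of z] that by force
  define C where "C = 1 + \<bar>M1\<bar> + \<bar>M2\<bar>"
  have "exp_cosh_tract f C"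
  proof
    show "f holomorphic_on UNIV" by fact
    show "1 \<le> C" by (simp add: C_def)
  next
    fix z :: complex assume z: "pi / 2 \<le> \<bar>Im z\<bar>"
    show "cmod (f z) \<le> C"
    proof (cases "\<bar>Im z\<bar> \<le> 5 * pi / 6")
      case True
      then have "\<bar>Im z\<bar> < pi" using pi_gt_zero by linarith
      then show ?thesis
        using near[OF True] norm_exp_cosh_le_1[OF cos_le_0_obtuse[OF z]]
          norm_triangle_ineq4[of "exp (cosh z)" "strip_Cauchy pi z"]
        unfolding C_def by (simp add: f_in del: norm_exp_eq_Re)
    next
      case False
      then have "2 * pi / 3 < \<bar>Im z\<bar>" using pi_gt_zero by linarith
      then show ?thesis using far[of z] False by (simp add: f_out C_def)
    qed
  next
    fix z :: complex assume z: "\<bar>Im z\<bar> \<le> pi / 2"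
    then have z': "\<bar>Im z\<bar> < pi" using pi_gt_zero by linarith
    show "cmod (f z - exp (cosh z)) \<le> C"
      using near[of z] z z' by (simp add: f_in C_def)
    have ball: "\<bar>Im w\<bar> \<le> 5 * pi / 6" if "cmod (z - w) \<le> pi / 3" for w
      using abs_Im_le_cmod[of "z - w"] that z by simp
    have hs: "strip_Cauchy pi holomorphic_on {w. \<bar>Im w\<bar> < pi}"
      by (intro holomorphic_strip_Cauchy cos) auto
    have sub: "cball z (pi / 3) \<subseteq> {w. \<bar>Im w\<bar> < pi}"
    proof
      fix w assume "w \<in> cball z (pi/3)"
      then have "\<bar>Im w\<bar> \<le> 5 * pi / 6" using ball[of w] by (simp add: dist_norm)
      then show "w \<in> {w. \<bar>Im w\<bar> < pi}" using pi_gt_zero by (simp, linarith)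
    qed
    \<comment> \<open>The disc of radius \<open>\<pi>/3\<close> about \<open>z\<close> stays in the region where \<open>near\<close> applies.\<close>
    have "cmod ((deriv ^^ 1) (strip_Cauchy pi) z) \<le> fact 1 * \<bar>M1\<bar> / (pi / 3) ^ 1"
    proof (rule Cauchy_inequality)
      show "strip_Cauchy pi holomorphic_on ball z (pi / 3)"
        by (rule holomorphic_on_subset[OF hs order_trans[OF ball_subset_cball sub]])
      show "continuous_on (cball z (pi / 3)) (strip_Cauchy pi)"
        by (rule holomorphic_on_imp_continuous_on, rule holomorphic_on_subset[OF hs sub])
      show "cmod (strip_Cauchy pi w) \<le> \<bar>M1\<bar>" if "cmod (z - w) = pi / 3" for w
        using near ball that by simp
    qed auto
    also have "\<dots> \<le> \<bar>M1\<bar>" using pi_gt3 by (simp add: divide_simps mult_left_mono)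
    finally have dS: "cmod (deriv (strip_Cauchy pi) z) \<le> \<bar>M1\<bar>" by simp
    have "(strip_Cauchy pi has_field_derivative deriv (strip_Cauchy pi) z) (at z)"
      using hs open_in z' by (auto intro: holomorphic_derivI)
    then have "((\<lambda>w. exp (cosh w) - strip_Cauchy pi w) has_field_derivative
        (sinh z * exp (cosh z) - deriv (strip_Cauchy pi) z)) (at z)"
      by (auto intro!: derivative_eq_intros)
    then have "(f has_field_derivative (sinh z * exp (cosh z) - deriv (strip_Cauchy pi) z)) (at z)"
      by (rule has_field_derivative_transform_within_open[OF _ open_in]) (use z' f_in in auto)
    then have "deriv f z = sinh z * exp (cosh z) - deriv (strip_Cauchy pi) z"
      by (rule DERIV_imp_deriv)
    then show "cmod (deriv f z - sinh z * exp (cosh z)) \<le> C"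
      using dS by (simp add: C_def)
  next
    fix x :: complex assume "x \<in> \<real>"
    then have x: "cnj x = x" "Im x = 0" by (auto simp: complex_is_Real_iff complex_eq_iff)
    have "cnj (f x) = f x"
      using x strip_Cauchy_cnj[of pi x] by (simp add: f_in cnj_cosh exp_cnj)
    then show "f x \<in> \<real>" by (simp add: Reals_cnj_iff)
  qed
  then show ?thesis by blast
qed

section \<open>Singular values and the escaping ray\<close>

lemma abs_Re_le_norm_cosh: "\<bar>Re z\<bar> \<le> 2 * cmod (cosh z)"
proof -
  have *: "Re z \<le> 2 * cmod (cosh z)" if "0 \<le> Re z" for z
  proof -
    have "1 + Re z + (Re z)\<^sup>2 / 2 \<le> exp (Re z)" by (rule exp_lower_Taylor_quadratic) fact
    moreover have "exp (- Re z) \<le> 1" using that by simp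
    moreover have "cmod (exp z) - cmod (exp (- z)) \<le> cmod (exp z + exp (- z))"
      by (rule norm_diff_ineq)
    moreover have "cmod (exp z + exp (- z)) = 2 * cmod (cosh z)"
      by (simp add: cosh_field_def norm_divide)
    moreover have "0 \<le> (Re z)\<^sup>2" by simp
    ultimately show ?thesis by (simp only: norm_exp_eq_Re uminus_complex.simps)
  qed
  show ?thesis using *[of z] *[of "- z"] by (cases "0 \<le> Re z") auto
qed

text \<open>
  A longer interval would contain a point of the form \<open>\<pi> + 2\<pi>k\<close>.
\<close>

lemma connected_reals_cos_pos:
  assumes J: "connected J" and pos: "\<And>y. y \<in> J \<Longrightarrow> 0 < cos y" and xy: "x \<in> J" "y \<in> J"
  shows "\<bar>x - y\<bar> \<le> 2 * pi"
proof -
  have *: "y \<le> x + 2 * pi" if "x \<in> J" "y \<in> J" for x y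
  proof (rule ccontr)
    assume "\<not> ?thesis"
    then have xy: "x + 2 * pi < y" by simp
    define k where "k = \<lceil>(x - pi) / (2 * pi)\<rceil>"
    have "(x - pi) / (2 * pi) \<le> of_int k" "of_int k < (x - pi) / (2 * pi) + 1"
      unfolding k_def by linarith+
    then have k: "x \<le> pi + 2 * pi * of_int k" "pi + 2 * pi * of_int k < x + 2 * pi"
      by (simp_all add: field_simps)
    then have "pi + 2 * pi * of_int k \<in> {x..y}" using xy by simp
    then have "pi + 2 * pi * of_int k \<in> J" using connected_contains_Icc[OF J that] by blast
    moreover have "cos (pi + 2 * pi * of_int k) = - 1"
      using cos_int_2pin[of k] sin_int_2pin[of k] by (simp add: cos_add)
    ultimately show False using pos by fastforce
  qed
  show ?thesis using *[of x y] *[of y x] xy by linarith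
qed

context exp_cosh_tract
begin

text \<open>
  \<open>exp (cosh x) \<ge> 1 + cosh x \<ge> 2 + x\<^sup>2 / 4\<close> beats \<open>x + 1 + C\<close> from \<open>4 + 4 * C\<close> on.
\<close>

lemma real_growth:
  assumes x: "4 + 4 * C \<le> x"
  shows "x + 1 \<le> Re (f (of_real x))"
proof -
  have "C * 1 \<le> (x / 4 - 1) * x" using x C_ge_1 by (intro mult_mono) auto
  then have "C + x \<le> x\<^sup>2 / 4" by (simp add: power2_eq_square algebra_simps)
  also have "\<dots> \<le> cosh x - 1" using cosh_real_ge_quadratic[of x] by simp
  finally have 1: "x + 1 + C \<le> exp (cosh x)" using exp_ge_add_one_self[of "cosh x"] by linarith
  have "\<bar>Re (f (of_real x) - exp (cosh (of_real x)))\<bar> \<le> C"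
    using abs_Re_le_cmod inside[of "of_real x"] order_trans by fastforce
  moreover have "Re (exp (cosh (complex_of_real x))) = exp (cosh x)"
    by (simp add: Re_exp Re_cosh Im_cosh)
  ultimately show ?thesis using 1 by simp
qed

lemma real_orbit:
  assumes x: "4 + 4 * C \<le> x"
  shows "\<exists>y. (f ^^ n) (of_real x) = of_real y \<and> x + real n \<le> y"
proof (induction n)
  case (Suc n)
  then obtain y where y: "(f ^^ n) (of_real x) = of_real y" "x + real n \<le> y" by blast
  have "f (of_real y) = of_real (Re (f (of_real y)))"
    using real[of "of_real y"] by (simp add: complex_is_Real_iff complex_eq_iff)
  then show ?case using y real_growth[of y] x by (intro exI[of _ "Re (f (of_real y))"]) auto
qed simp

lemma real_ray_escapes:
  assumes x: "4 + 4 * C \<le> x"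
  shows "of_real x \<in> escaping_set f"
  unfolding escaping_set_def mem_Collect_eq
proof (rule filterlim_norm_at_top_imp_at_infinity)
  show "filterlim (\<lambda>n. norm ((f ^^ n) (of_real x))) at_top sequentially"
  proof (rule filterlim_at_top_mono[OF filterlim_real_sequentially], intro always_eventually allI)
    fix n
    obtain y where "(f ^^ n) (of_real x) = of_real y" "x + real n \<le> y" using real_orbit[OF x] by blast
    then show "real n \<le> norm ((f ^^ n) (of_real x))" using x C_ge_1 by simp
  qed
qed

lemma unbounded_on_reals: "\<not> bounded (range f)"
proof
  assume "bounded (range f)"
  then obtain B where B: "\<And>z. cmod (f z) \<le> B" by (auto simp: bounded_iff)
  let ?x = "max (4 + 4 * C) B"
  have "?x + 1 \<le> Re (f (of_real ?x))" by (rule real_growth) simp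
  then show False using B[of "of_real ?x"] complex_Re_le_cmod[of "f (of_real ?x)"] by linarith
qed

lemma not_constant: "\<not> f constant_on UNIV"
proof
  assume "f constant_on UNIV"
  then obtain c where "f = (\<lambda>_. c)" by (auto simp: constant_on_def)
  then show False using unbounded_on_reals by simp
qed

text \<open>
  A nonconstant polynomial would tend to infinity along the line \<open>Im z = \<pi>\<close>, where \<open>f\<close> is bounded.
\<close>

lemma transcendental: "transcendental_entire f"
  unfolding transcendental_entire_def
proof (intro conjI holo notI)
  assume "\<exists>p. \<forall>z. f z = poly p z"
  then obtain p where p: "f = poly p" by blast
  show False
  proof (cases "degree p = 0")
    case True
    then obtain c where "p = [:c:]" by (rule degree_eq_zeroE)
    then show False using unbounded_on_reals p by simp
  next
    case False
    have "filterlim (\<lambda>n. Complex (real n) pi) at_infinity sequentially"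
    proof (rule filterlim_norm_at_top_imp_at_infinity, rule filterlim_at_top_mono[OF filterlim_real_sequentially], intro always_eventually allI)
      show "real n \<le> norm (Complex (real n) pi)" for n
        using complex_Re_le_cmod[of "Complex (real n) pi"] by simp
    qed
    then have "filterlim (\<lambda>n. f (Complex (real n) pi)) at_infinity sequentially"
      unfolding p using filterlim_compose[OF filterlim_poly_at_infinity] False by blast
    then have "filterlim (\<lambda>n. norm (f (Complex (real n) pi))) at_top sequentially"
      by (rule filterlim_at_infinity_imp_norm_at_top)
    then have "\<forall>\<^sub>F n in sequentially. C + 1 \<le> norm (f (Complex (real n) pi))"
      unfolding filterlim_at_top by blast
    then obtain n where "C + 1 \<le> norm (f (Complex (real n) pi))"
      unfolding eventually_sequentially by blast
    then show False using outside[of "Complex (real n) pi"] by simp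
  qed
qed

text \<open>
  At a critical point in the strip, \<open>sinh z * exp (cosh z)\<close> has modulus at most \<open>C\<close>. Either \<open>\<bar>sinh z\<bar> \<ge> 1\<close> and
  \<open>exp (cosh z)\<close> is small, or \<open>sinh z\<close> is small and then \<open>cosh z\<close> is bounded.
\<close>

lemma critical_value_bound:
  assumes "deriv f z = 0"
  shows "cmod (f z) \<le> exp 2 + 2 * C"
proof (cases "pi / 2 \<le> \<bar>Im z\<bar>")
  case True
  then show ?thesis using outside C_ge_1 exp_gt_zero[of "2::real"] by (smt (verit))
next
  case False
  then have z: "\<bar>Im z\<bar> \<le> pi / 2" by simp
  have d: "cmod (sinh z) * cmod (exp (cosh z)) \<le> C"
    using inside_deriv[OF z] assms by (simp add: norm_mult del: norm_exp_eq_Re)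
  have "cmod (exp (cosh z)) \<le> exp 2 + C"
  proof (cases "cmod (sinh z) < 1")
    case True
    have "cosh z ^ 2 = sinh z ^ 2 + 1" using cosh_square_eq[of z] by simp
    then have "cmod (cosh z) ^ 2 \<le> cmod (sinh z) ^ 2 + 1"
      by (metis norm_one norm_power norm_triangle_ineq)
    also have "\<dots> \<le> 2\<^sup>2" using True power_le_one[of "cmod (sinh z)" 2] by (simp add: less_imp_le)
    finally have "cmod (cosh z) \<le> 2" by (rule power2_le_imp_le) simp
    then have "Re (cosh z) \<le> 2" using complex_Re_le_cmod order_trans by blast
    then show ?thesis using C_ge_1 by (simp add: add_increasing2)
  next
    case False
    then have "1 * cmod (exp (cosh z)) \<le> cmod (sinh z) * cmod (exp (cosh z))"
      by (intro mult_right_mono) auto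
    then show ?thesis using d exp_gt_zero[of "2::real"] by linarith
  qed
  then show ?thesis using inside[OF z] norm_triangle_ineq2[of "f z" "exp (cosh z)"] by linarith
qed

text \<open>
  If \<open>\<bar>w\<bar>\<close> is large compared with \<open>C\<close>, the path ends in the strip and \<open>exp (cosh \<gamma>) / w\<close> stays within
  1/2 of 1. So \<open>\<zeta> = cosh \<gamma> - Ln w\<close> has bounded real part and \<open>cos (Im \<zeta>) > 0\<close>, and by connectedness its
  imaginary part is bounded too. Thus \<open>cosh \<gamma>\<close> is bounded, and with it \<open>\<gamma>\<close>.
\<close>

lemma asymptotic_value_bound:
  assumes "w \<in> asymptotic_values f"
  shows "cmod w \<le> 2 * C + 2"
proof (rule ccontr)
  assume "\<not> ?thesis"
  then have w: "2 * C + 2 < cmod w" by simp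
  then have w0: "w \<noteq> 0" using C_ge_1 by auto
  obtain \<gamma> :: "real \<Rightarrow> complex" where \<gamma>: "continuous_on {0..} \<gamma>" "filterlim \<gamma> at_infinity at_top"
      "((\<lambda>t. f (\<gamma> t)) \<longlongrightarrow> w) at_top"
    using assms by (auto simp: asymptotic_values_def)
  have "\<forall>\<^sub>F t in at_top. dist (f (\<gamma> t)) w < 1" using \<gamma>(3) by (rule tendstoD) simp
  then obtain t0 where t0: "\<And>t. t0 \<le> t \<Longrightarrow> dist (f (\<gamma> t)) w < 1"
    unfolding eventually_at_top_linorder by blast
  define T where "T = {max 0 t0..}"
  have T: "cmod (f (\<gamma> t) - w) < 1" if "t \<in> T" for t using t0[of t] that by (simp add: T_def dist_norm)
  have strip: "\<bar>Im (\<gamma> t)\<bar> < pi / 2" if "t \<in> T" for t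
  proof (rule ccontr)
    assume "\<not> ?thesis"
    then have "cmod (f (\<gamma> t)) \<le> C" using outside by simp
    then show False using T[OF that] w C_ge_1 norm_triangle_ineq3[of w "f (\<gamma> t)"]
      by (simp add: norm_minus_commute)
  qed
  define \<zeta> where "\<zeta> t = cosh (\<gamma> t) - Ln w" for t
  have exp_\<zeta>: "cmod (exp (\<zeta> t) - 1) < 1 / 2" if "t \<in> T" for t
  proof -
    have "cmod (exp (cosh (\<gamma> t)) - w) < C + 1"
      using T[OF that] inside[OF less_imp_le[OF strip[OF that]]]
        norm_triangle_ineq[of "exp (cosh (\<gamma> t)) - f (\<gamma> t)" "f (\<gamma> t) - w"]
      by (simp add: norm_minus_commute)
    also have "\<dots> < cmod w / 2" using w by simp
    finally have "cmod (exp (cosh (\<gamma> t)) - w) / cmod w < 1 / 2" using w0 by (simp add: divide_simps)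
    moreover have "exp (\<zeta> t) - 1 = (exp (cosh (\<gamma> t)) - w) / w"
      using w0 by (simp add: \<zeta>_def exp_diff divide_simps)
    ultimately show ?thesis by (simp add: norm_divide)
  qed
  have cos_pos: "0 < cos (Im (\<zeta> t))" if "t \<in> T" for t
  proof -
    have "\<bar>Re (exp (\<zeta> t) - 1)\<bar> < 1 / 2" using exp_\<zeta>[OF that] abs_Re_le_cmod order.strict_trans1 by blast
    then have "0 < Re (exp (\<zeta> t))" unfolding minus_complex.simps one_complex.simps by linarith
    then show ?thesis by (simp add: Re_exp zero_less_mult_iff)
  qed
  have Re_\<zeta>: "\<bar>Re (\<zeta> t)\<bar> \<le> 1" if "t \<in> T" for t
  proof -
    have "\<bar>cmod (exp (\<zeta> t)) - 1\<bar> < 1 / 2"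
      using exp_\<zeta>[OF that] norm_triangle_ineq3[of "exp (\<zeta> t)" 1] by (simp del: norm_exp_eq_Re)
    then have e: "1 / 2 < exp (Re (\<zeta> t))" "exp (Re (\<zeta> t)) < 3 / 2"
      unfolding norm_exp_eq_Re by linarith+
    have "1 + Re (\<zeta> t) < 3 / 2" using e exp_ge_add_one_self[of "Re (\<zeta> t)"] by linarith
    moreover have "1 - Re (\<zeta> t) < 2"
    proof -
      have "1 + - Re (\<zeta> t) \<le> exp (- Re (\<zeta> t))" by (rule exp_ge_add_one_self)
      also have "\<dots> < 2" using e(1) by (simp add: exp_minus inverse_eq_divide divide_simps)
      finally show ?thesis by simp
    qed
    ultimately show ?thesis by simp
  qed
  have "continuous_on T \<gamma>" using \<gamma>(1) by (rule continuous_on_subset) (auto simp: T_def)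
  then have "continuous_on T (\<lambda>t. Im (\<zeta> t))"
    unfolding \<zeta>_def cosh_field_def by (intro continuous_intros) auto
  then have "connected ((\<lambda>t. Im (\<zeta> t)) ` T)"
    by (rule connected_continuous_image) (simp add: T_def)
  note J = this
  have osc: "\<bar>Im (\<zeta> t) - Im (\<zeta> (max 0 t0))\<bar> \<le> 2 * pi" if "t \<in> T" for t
    by (rule connected_reals_cos_pos[OF J]) (use cos_pos that in \<open>auto simp: T_def\<close>)
  define K where "K = 1 + (\<bar>Im (\<zeta> (max 0 t0))\<bar> + 2 * pi) + cmod (Ln w)"
  have bounded: "cmod (\<gamma> t) \<le> 2 * K + pi / 2" if "t \<in> T" for t
  proof -
    have "cmod (cosh (\<gamma> t)) \<le> cmod (\<zeta> t) + cmod (Ln w)"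
      using norm_triangle_ineq[of "\<zeta> t" "Ln w"] by (simp add: \<zeta>_def)
    also have "cmod (\<zeta> t) \<le> \<bar>Re (\<zeta> t)\<bar> + \<bar>Im (\<zeta> t)\<bar>" by (rule cmod_le)
    also have "\<dots> \<le> 1 + (\<bar>Im (\<zeta> (max 0 t0))\<bar> + 2 * pi)"
      using Re_\<zeta>[OF that] osc[OF that] by linarith
    finally have "cmod (cosh (\<gamma> t)) \<le> K" by (simp add: K_def)
    then have "\<bar>Re (\<gamma> t)\<bar> \<le> 2 * K" using abs_Re_le_norm_cosh[of "\<gamma> t"] by simp
    then show ?thesis using cmod_le[of "\<gamma> t"] strip[OF that] by linarith
  qed
  have "filterlim (\<lambda>t. cmod (\<gamma> t)) at_top at_top"
    using \<gamma>(2) by (rule filterlim_at_infinity_imp_norm_at_top)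
  then have "\<forall>\<^sub>F t in at_top. 2 * K + pi / 2 + 1 \<le> cmod (\<gamma> t)" unfolding filterlim_at_top by blast
  moreover have "\<forall>\<^sub>F t in at_top. t \<in> T" using eventually_ge_at_top[of "max 0 t0"] by (simp add: T_def)
  ultimately have "\<forall>\<^sub>F t::real in at_top. False"
    by eventually_elim (use bounded in fastforce)
  then show False by simp
qed

lemma in_Eremenko_Lyubich_class: "f \<in> Eremenko_Lyubich_class"
proof -
  have "cmod v \<le> exp 2 + 2 * C + 2" if "v \<in> sing_inverse f" for v
    using that unfolding sing_inverse_def
  proof
    assume "v \<in> critical_values f"
    then show ?thesis using critical_value_bound by (force simp: critical_values_def)
  next
    assume "v \<in> asymptotic_values f"
    then show ?thesis using asymptotic_value_bound[of v] exp_gt_zero[of "2::real"] by linarith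
  qed
  then show ?thesis
    using transcendental by (auto simp: Eremenko_Lyubich_class_def bounded_iff)
qed

lemma escaping_set_dim_ge_1: "1 \<le> hausdorff_dim (escaping_set f)"
  by (rule hausdorff_dim_ge_1_if_real_segment[of "4 + 4 * C"]) (auto intro: real_ray_escapes)

end

section \<open>Expansion in the tract\<close>

lemma norm_Ln_diff_le:
  assumes "convex S" "S \<inter> \<real>\<^sub>\<le>\<^sub>0 = {}" and r: "0 < r" "\<And>\<xi>. \<xi> \<in> S \<Longrightarrow> r \<le> cmod \<xi>" and "a \<in> S" "b \<in> S"
  shows "cmod (Ln a - Ln b) \<le> cmod (a - b) / r"
proof -
  have "cmod (Ln a - Ln b) \<le> (1 / r) * cmod (a - b)"
  proof (rule field_differentiable_bound[OF assms(1) _ _ assms(5,6)])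
    fix \<xi> assume \<xi>: "\<xi> \<in> S"
    then show "(Ln has_field_derivative inverse \<xi>) (at \<xi> within S)"
      using assms(2) by (intro has_field_derivative_at_within[OF has_field_derivative_Ln]) auto
    show "cmod (inverse \<xi>) \<le> 1 / r"
      using r(2)[OF \<xi>] r(1) by (simp add: norm_inverse le_imp_inverse_le flip: inverse_eq_divide)
  qed
  then show ?thesis by simp
qed

text \<open>
  With \<open>A = exp z\<close> one has \<open>2 * cosh z = A + 1 / A\<close>, so \<open>A\<close> is within 1 of \<open>2 * cosh z\<close>; hence \<open>Re A \<ge> 3\<close> and
  \<open>Im A\<close> is within \<open>\<pi> + 1\<close> of \<open>2\<pi>k\<close>. The convex set \<open>S\<close> of such points stays at distance at least \<open>1 + \<bar>k\<bar>\<close> from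
  the origin, so \<open>Ln\<close> contracts on it by that factor, while \<open>A + 1 / A\<close> distorts distances only by a
  bounded factor.
\<close>

lemma cosh_expansion:
  fixes k :: int
  assumes Im: "\<bar>Im z\<bar> \<le> pi / 2" "\<bar>Im w\<bar> \<le> pi / 2" and Re: "0 \<le> Re z" "0 \<le> Re w"
    and Rc: "2 \<le> Re (cosh z)" "2 \<le> Re (cosh w)"
    and Ic: "\<bar>Im (cosh z) - pi * k\<bar> \<le> pi / 2" "\<bar>Im (cosh w) - pi * k\<bar> \<le> pi / 2"
  shows "(1 + \<bar>k\<bar>) * cmod (z - w) \<le> 4 * cmod (cosh z - cosh w)"
proof -
  define S where "S = {\<xi>. 3 \<le> Re \<xi>} \<inter> {\<xi>. 2 * pi * k - (pi + 1) \<le> Im \<xi>} \<inter> {\<xi>. Im \<xi> \<le> 2 * pi * k + (pi + 1)}"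
  have S: "exp z \<in> S \<and> Ln (exp z) = z \<and> 3 \<le> cmod (exp z)"
    if z: "\<bar>Im z\<bar> \<le> pi / 2" "0 \<le> Re z" "2 \<le> Re (cosh z)" "\<bar>Im (cosh z) - pi * k\<bar> \<le> pi / 2" for z
  proof -
    have sum: "exp z + exp (- z) = 2 * cosh z" by (simp add: cosh_field_def)
    have small: "cmod (exp (- z)) \<le> 1" using z by simp
    have "Re (exp z) = 2 * Re (cosh z) - Re (exp (- z))" "Im (exp z) = 2 * Im (cosh z) - Im (exp (- z))"
      using arg_cong[OF sum, of Re] arg_cong[OF sum, of Im] by auto
    moreover have "\<bar>Re (exp (- z))\<bar> \<le> 1" "\<bar>Im (exp (- z))\<bar> \<le> 1"
      using small abs_Re_le_cmod abs_Im_le_cmod order_trans by blast+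
    ultimately have "3 \<le> Re (exp z)" "\<bar>Im (exp z) - 2 * pi * k\<bar> \<le> pi + 1"
      using z by linarith+
    moreover have "Ln (exp z) = z" using z pi_gt_zero by (intro Ln_exp) linarith+
    ultimately show ?thesis using complex_Re_le_cmod[of "exp z"] unfolding S_def by auto
  qed
  note Sz = S[OF Im(1) Re(1) Rc(1) Ic(1)] and Sw = S[OF Im(2) Re(2) Rc(2) Ic(2)]
  have far: "1 + real_of_int \<bar>k\<bar> \<le> cmod \<xi>" if "\<xi> \<in> S" for \<xi>
  proof (cases "\<bar>k\<bar> \<le> 2")
    case True
    then have "real_of_int \<bar>k\<bar> \<le> 2" by linarith
    then show ?thesis using that complex_Re_le_cmod[of \<xi>] by (simp add: S_def)
  next
    case False
    then have k: "3 \<le> real_of_int \<bar>k\<bar>" by linarith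
    have "2 * pi * \<bar>k\<bar> - (pi + 1) \<le> \<bar>Im \<xi>\<bar>"
    proof -
      have "\<bar>Im \<xi> - 2 * pi * k\<bar> \<le> pi + 1" using that by (auto simp: S_def)
      moreover have "\<bar>2 * pi * k\<bar> = 2 * pi * \<bar>k\<bar>" by (simp add: abs_mult)
      ultimately show ?thesis by linarith
    qed
    moreover have "pi * (2 * real_of_int \<bar>k\<bar> - 1) \<ge> 3 * (2 * real_of_int \<bar>k\<bar> - 1)"
      using pi_gt3 k by (intro mult_right_mono) auto
    ultimately show ?thesis using abs_Im_le_cmod[of \<xi>] k by (simp add: algebra_simps)
  qed
  have "cmod (Ln (exp z) - Ln (exp w)) \<le> cmod (exp z - exp w) / (1 + \<bar>k\<bar>)"
  proof (rule norm_Ln_diff_le)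
    show "convex S" unfolding S_def
      by (intro convex_Int convex_halfspace_Re_ge convex_halfspace_Im_ge convex_halfspace_Im_le)
    show "S \<inter> \<real>\<^sub>\<le>\<^sub>0 = {}" by (auto simp: S_def complex_nonpos_Reals_iff)
  qed (use Sz Sw far in auto)
  then have 1: "(1 + \<bar>k\<bar>) * cmod (z - w) \<le> cmod (exp z - exp w)"
    using Sz Sw by (simp add: field_simps)
  have "cmod (exp z - exp w) \<le> 4 * cmod (cosh z - cosh w)"
  proof -
    have eq: "2 * (cosh z - cosh w) = (exp z - exp w) * (1 - 1 / (exp z * exp w))"
      by (simp add: cosh_field_def exp_minus field_simps)
    have "3 * 3 \<le> cmod (exp z) * cmod (exp w)" using Sz Sw by (intro mult_mono) auto
    then have "cmod (1 / (exp z * exp w)) \<le> 1 / 9"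
      unfolding norm_divide norm_mult norm_one by (intro frac_le) auto
    then have "1 / 2 \<le> cmod (1 - 1 / (exp z * exp w))"
      using norm_triangle_ineq2[of 1 "1 / (exp z * exp w)"] by simp
    then have "cmod (exp z - exp w) * (1 / 2) \<le> cmod (2 * (cosh z - cosh w))"
      unfolding eq norm_mult by (intro mult_left_mono) auto
    then show ?thesis unfolding norm_mult by simp
  qed
  with 1 show ?thesis by linarith
qed

context exp_cosh_tract
begin

definition error_term :: "complex \<Rightarrow> complex" where
  "error_term z = f z - exp (cosh z)"

lemma error_term_le: "\<bar>Im z\<bar> \<le> pi / 2 \<Longrightarrow> cmod (error_term z) \<le> C"
  using inside by (simp add: error_term_def)

lemma error_term_Lipschitz:
  assumes "\<bar>Im z\<bar> \<le> pi / 2" "\<bar>Im w\<bar> \<le> pi / 2"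
  shows "cmod (error_term z - error_term w) \<le> C * cmod (z - w)"
proof -
  let ?S = "{z. - (pi / 2) \<le> Im z} \<inter> {z. Im z \<le> pi / 2}"
  show ?thesis
  proof (rule field_differentiable_bound)
    show "convex ?S" by (intro convex_Int convex_halfspace_Im_ge convex_halfspace_Im_le)
    fix \<xi> assume \<xi>: "\<xi> \<in> ?S"
    have "(f has_field_derivative deriv f \<xi>) (at \<xi>)"
      using holo by (rule holomorphic_derivI) auto
    then have "(error_term has_field_derivative (deriv f \<xi> - sinh \<xi> * exp (cosh \<xi>))) (at \<xi>)"
      unfolding error_term_def[abs_def] by (auto intro!: derivative_eq_intros)
    then show "(error_term has_field_derivative (deriv f \<xi> - sinh \<xi> * exp (cosh \<xi>))) (at \<xi> within ?S)"
      by (rule has_field_derivative_at_within)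
    show "cmod (deriv f \<xi> - sinh \<xi> * exp (cosh \<xi>)) \<le> C"
      using \<xi> by (intro inside_deriv) auto
  qed (use assms in auto)
qed

text \<open>
  Lift to logarithms: \<open>exp (cosh z) = f z - error_term z\<close>, and \<open>cosh z - \<pi>\<i>k\<close> lies in the strip
  \<open>\<bar>Im\<bar> \<le> \<pi>/2\<close>, where \<open>Ln\<close> inverts \<open>exp\<close> and contracts by \<open>m / 2\<close>, since the image points are at least
  \<open>m - C \<ge> m / 2\<close> from the imaginary axis. The multiples of \<open>\<pi>\<close> rather than of \<open>2\<pi>\<close> allow for
  values of \<open>f\<close> in either of the two half-strips. Combining this with \<open>cosh_expansion\<close>, the
  Lipschitz error is absorbed into the left-hand side because \<open>8 * C / m \<le> 1 / 2\<close>.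
\<close>

lemma expansion:
  fixes k :: int and m :: real
  assumes Im: "\<bar>Im z\<bar> \<le> pi / 2" "\<bar>Im w\<bar> \<le> pi / 2"
    and side: "0 \<le> Re z \<and> 0 \<le> Re w \<or> Re z \<le> 0 \<and> Re w \<le> 0"
    and Ic: "\<bar>Im (cosh z) - pi * k\<bar> \<le> pi / 2" "\<bar>Im (cosh w) - pi * k\<bar> \<le> pi / 2"
    and m: "18 * C \<le> m" and Ref: "m \<le> \<bar>Re (f z)\<bar>" "m \<le> \<bar>Re (f w)\<bar>"
  shows "cmod (z - w) \<le> 16 / ((1 + \<bar>k\<bar>) * m) * cmod (f z - f w)"
proof -
  have m0: "0 < m" "9 \<le> m / 2" using m C_ge_1 by auto
  define \<sigma> where "\<sigma> = exp (\<i> * of_real (pi * k))"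
  have \<sigma>: "\<sigma> = of_real (cos (pi * k))" "\<bar>cos (pi * k)\<bar> = 1"
    using sin_zero_iff_int2[of "pi * k"] sin_squared_eq[of "pi * k"]
    unfolding \<sigma>_def
    by (auto simp: complex_eq_iff Re_exp Im_exp power2_eq_1_iff mult.commute)
  define a where "a z = cosh z - \<i> * of_real (pi * k)" for z
  have a: "exp (a z) \<in> {\<xi>. m / 2 \<le> Re \<xi>} \<and> Ln (exp (a z)) = a z \<and> 2 \<le> Re (cosh z)"
    if z: "\<bar>Im z\<bar> \<le> pi / 2" "\<bar>Im (cosh z) - pi * k\<bar> \<le> pi / 2" "m \<le> \<bar>Re (f z)\<bar>" for z
  proof -
    have "exp (cosh z) = f z - error_term z" by (simp add: error_term_def)
    then have "Re (exp (cosh z)) = Re (f z) - Re (error_term z)" by simp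
    moreover have "\<bar>Re (error_term z)\<bar> \<le> C" using error_term_le[OF z(1)] abs_Re_le_cmod order_trans by blast
    moreover have "C \<le> m / 18" using m by simp
    ultimately have big: "m / 2 \<le> \<bar>Re (exp (cosh z))\<bar>"
      using z(3) m0 by linarith
    have "exp (cosh z) = \<sigma> * exp (a z)" unfolding \<sigma>_def a_def by (simp flip: exp_add)
    then have "\<bar>Re (exp (cosh z))\<bar> = \<bar>Re (exp (a z))\<bar>" using \<sigma> by (simp add: abs_mult)
    moreover have "0 \<le> Re (exp (a z))"
      using z(2) unfolding Re_exp a_def abs_le_iff by (intro mult_nonneg_nonneg cos_ge_zero) auto
    ultimately have Re: "m / 2 \<le> Re (exp (a z))" using big by linarith
    have "Ln (exp (a z)) = a z"
    proof (rule Ln_exp)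
      have "Im (a z) = Im (cosh z) - pi * k" by (simp add: a_def)
      then show "- pi < Im (a z)" "Im (a z) \<le> pi" using z(2) pi_gt_zero by linarith+
    qed
    moreover have "2 \<le> Re (cosh z)"
    proof -
      \<comment> \<open>\<open>e\<^sup>2 \<le> 9 \<le> m / 2\<close> is the reason for the constant 18.\<close>
      have "exp 2 = (exp 1 :: real)\<^sup>2" by (simp flip: exp_double)
      also have "\<dots> \<le> 3\<^sup>2" by (intro power_mono exp_le) auto
      also have "\<dots> \<le> m / 2" using m0 by simp
      also have "\<dots> \<le> cmod (exp (cosh z))" using big abs_Re_le_cmod order_trans by blast
      finally show ?thesis by simp
    qed
    ultimately show ?thesis using Re by simp
  qed
  note az = a[OF Im(1) Ic(1) Ref(1)] and aw = a[OF Im(2) Ic(2) Ref(2)]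
  have 1: "(1 + \<bar>k\<bar>) * cmod (z - w) \<le> 4 * cmod (cosh z - cosh w)"
  proof (cases "0 \<le> Re z \<and> 0 \<le> Re w")
    case True
    then show ?thesis using cosh_expansion[of z w k] Im Ic az aw by blast
  next
    case False
    \<comment> \<open>The left half-strip reduces to the right one, \<open>cosh\<close> being even.\<close>
    then have "(1 + \<bar>k\<bar>) * cmod (- z - - w) \<le> 4 * cmod (cosh (- z) - cosh (- w))"
      using side Im Ic az aw by (intro cosh_expansion[of "- z" "- w" k]) auto
    then show ?thesis by (simp add: norm_minus_commute)
  qed
  have "cmod (cosh z - cosh w) = cmod (Ln (exp (a z)) - Ln (exp (a w)))"
    using az aw by (simp add: a_def)
  also have "\<dots> \<le> cmod (exp (a z) - exp (a w)) / (m / 2)"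
  proof (rule norm_Ln_diff_le)
    show "convex {\<xi>. m / 2 \<le> Re \<xi>}" by (rule convex_halfspace_Re_ge)
    show "{\<xi>. m / 2 \<le> Re \<xi>} \<inter> \<real>\<^sub>\<le>\<^sub>0 = {}" using m0 by (auto simp: complex_nonpos_Reals_iff)
    show "m / 2 \<le> cmod \<xi>" if "\<xi> \<in> {\<xi>. m / 2 \<le> Re \<xi>}" for \<xi>
      using that complex_Re_le_cmod[of \<xi>] by simp
  qed (use m0 az aw in auto)
  also have "cmod (exp (a z) - exp (a w)) = cmod (exp (cosh z) - exp (cosh w))"
  proof -
    have "exp (cosh z) - exp (cosh w) = \<sigma> * (exp (a z) - exp (a w))"
      unfolding \<sigma>_def a_def right_diff_distrib by (simp flip: exp_add)
    then show ?thesis using \<sigma> by (simp add: norm_mult)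
  qed
  also have "\<dots> \<le> cmod (f z - f w) + C * cmod (z - w)"
  proof -
    have "exp (cosh z) - exp (cosh w) = (f z - f w) - (error_term z - error_term w)" by (simp add: error_term_def)
    then show ?thesis
      using norm_triangle_ineq4[of "f z - f w" "error_term z - error_term w"] error_term_Lipschitz[OF Im] by simp
  qed
  finally have "cmod (cosh z - cosh w) \<le> (cmod (f z - f w) + C * cmod (z - w)) / (m / 2)"
    using m0 by (simp add: divide_right_mono)
  moreover have "4 * ((cmod (f z - f w) + C * cmod (z - w)) / (m / 2))
      = 8 * cmod (f z - f w) / m + (8 * C / m) * cmod (z - w)"
    using m0 by (simp add: field_simps)
  ultimately have "(1 + \<bar>k\<bar>) * cmod (z - w) \<le> 8 * cmod (f z - f w) / m + (8 * C / m) * cmod (z - w)"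
    using 1 by linarith
  also have "(8 * C / m) * cmod (z - w) \<le> (1 / 2) * ((1 + \<bar>k\<bar>) * cmod (z - w))"
  proof -
    have "8 * C / m \<le> 1 / 2" using m m0 by (simp add: field_simps)
    then have "(8 * C / m) * cmod (z - w) \<le> (1 / 2) * cmod (z - w)" by (intro mult_right_mono) auto
    also have "\<dots> \<le> (1 / 2) * ((1 + \<bar>k\<bar>) * cmod (z - w))"
      by (simp add: algebra_simps)
    finally show ?thesis .
  qed
  finally have "(1 + \<bar>k\<bar>) * cmod (z - w) \<le> 16 * cmod (f z - f w) / m" by simp
  then have "cmod (z - w) * ((1 + \<bar>k\<bar>) * m) \<le> 16 * cmod (f z - f w)"
    using m0 by (simp add: pos_le_divide_eq mult_ac)
  moreover have "0 < (1 + real_of_int \<bar>k\<bar>) * m"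
    using m0 by (intro mult_pos_pos) auto
  ultimately show ?thesis by (simp add: pos_le_divide_eq)
qed

end

section \<open>The Hausdorff dimension of the escaping set\<close>

text \<open>
  Near a point that is not critical \<open>f\<close> is bi-Lipschitz, countably many such neighbourhoods cover the
  complement of the critical points, and there are only countably many critical points.
\<close>

lemma vimage_hausdorff_content_eq_0:
  fixes f :: "complex \<Rightarrow> complex"
  assumes holo: "f holomorphic_on UNIV" and nc: "\<not> f constant_on UNIV"
    and B: "hausdorff_content s B = 0" and s: "0 \<le> s"
  shows "hausdorff_content s (f -` B) = 0"
proof -
  define crit where "crit = {z. deriv f z = 0}"
  have dholo: "deriv f holomorphic_on UNIV" using holo by (rule holomorphic_deriv) auto
  have D: "(f has_field_derivative deriv f z) (at z)" for z
    using holo by (rule holomorphic_derivI) auto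
  have crit: "countable crit"
  proof (cases "deriv f constant_on UNIV")
    case False
    then show ?thesis
      using holomorphic_countable_zeros[OF dholo open_UNIV connected_UNIV fsigma_UNIV False] by (simp add: crit_def)
  next
    case True
    then obtain c where c: "\<And>z. deriv f z = c" by (auto simp: constant_on_def)
    have "c \<noteq> 0"
    proof
      assume "c = 0"
      then have "\<exists>d. \<forall>z\<in>UNIV. f z = d"
        using D c by (intro has_field_derivative_zero_constant) (auto intro: has_field_derivative_at_within)
      then show False using nc by (auto simp: constant_on_def)
    qed
    then show ?thesis using c by (simp add: crit_def)
  qed
  define good where "good V \<longleftrightarrow> open V \<and> (\<exists>L>0. \<forall>z\<in>V. \<forall>w\<in>V. dist z w \<le> L * dist (f z) (f w))" for V
  have locally_expanding: "\<exists>V. good V \<and> p \<in> V" if p: "p \<notin> crit" for p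
  proof -
    define c where "c = deriv f p"
    have c: "c \<noteq> 0" using p by (simp add: c_def crit_def)
    have "isCont (deriv f) p"
      using holomorphic_on_imp_continuous_on[OF dholo] by (simp add: continuous_on_eq_continuous_at)
    then obtain r where r: "0 < r" "\<And>z. dist z p < r \<Longrightarrow> dist (deriv f z) c < cmod c / 2"
      unfolding continuous_at_eps_delta c_def using c by (metis c_def half_gt_zero zero_less_norm_iff)
    have "dist z w \<le> 2 / cmod c * dist (f z) (f w)" if "z \<in> ball p r" "w \<in> ball p r" for z w
    proof -
      have "cmod ((f z - c * z) - (f w - c * w)) \<le> cmod c / 2 * cmod (z - w)"
      proof (rule field_differentiable_bound[OF convex_ball _ _ that])
        fix \<xi> assume \<xi>: "\<xi> \<in> ball p r"
        show "((\<lambda>z. f z - c * z) has_field_derivative (deriv f \<xi> - c)) (at \<xi> within ball p r)"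
          by (auto intro!: derivative_eq_intros has_field_derivative_at_within[OF D])
        show "cmod (deriv f \<xi> - c) \<le> cmod c / 2"
          using r(2)[of \<xi>] \<xi> by (simp add: dist_norm norm_minus_commute)
      qed
      moreover have "cmod (c * (z - w)) \<le> cmod (f z - f w) + cmod ((f z - c * z) - (f w - c * w))"
        using norm_triangle_ineq4[of "f z - f w" "(f z - c * z) - (f w - c * w)"]
        by (simp add: algebra_simps)
      ultimately have "cmod c * cmod (z - w) \<le> 2 * cmod (f z - f w)" by (simp add: norm_mult)
      then show ?thesis using c by (simp add: dist_norm field_simps)
    qed
    then have "good (ball p r)" unfolding good_def using c
      by (intro conjI open_ball exI[of _ "2 / cmod c"]) auto
    then show ?thesis using r(1) by (intro exI[of _ "ball p r"]) auto
  qed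
  obtain \<F> where \<F>: "\<F> \<subseteq> Collect good" "countable \<F>" "\<Union>\<F> = \<Union>(Collect good)"
    using Lindelof[of "Collect good"] by (auto simp: good_def)
  have "f -` B \<subseteq> (\<Union>x\<in>crit. {x}) \<union> (\<Union>V\<in>\<F>. f -` B \<inter> V)"
  proof
    fix p assume p: "p \<in> f -` B"
    show "p \<in> (\<Union>x\<in>crit. {x}) \<union> (\<Union>V\<in>\<F>. f -` B \<inter> V)"
    proof (cases "p \<in> crit")
      case False
      then have "p \<in> \<Union>\<F>" unfolding \<F>(3) using locally_expanding[of p] by auto
      then show ?thesis using p by auto
    qed auto
  qed
  then have "hausdorff_content s (f -` B)
      \<le> hausdorff_content s (\<Union>x\<in>crit. {x}) + hausdorff_content s (\<Union>V\<in>\<F>. f -` B \<inter> V)"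
    using hausdorff_content_mono hausdorff_content_Un_le order_trans by blast
  moreover have "hausdorff_content s (\<Union>x\<in>crit. {x}) = 0"
    by (rule hausdorff_content_countable_Union_eq_0[OF crit]) simp
  moreover have "hausdorff_content s (\<Union>V\<in>\<F>. f -` B \<inter> V) = 0"
  proof (rule hausdorff_content_countable_Union_eq_0[OF \<F>(2)])
    fix V assume "V \<in> \<F>"
    then have "good V" using \<F>(1) by (auto dest: subsetD)
    then obtain L where L: "L > 0" "\<forall>z\<in>V. \<forall>w\<in>V. dist z w \<le> L * dist (f z) (f w)"
      unfolding good_def by blast
    have "hausdorff_content s (f -` B \<inter> V) \<le> ennreal (L powr s) * hausdorff_content s B"
      by (rule hausdorff_content_le_expansion[where g=f]) (use L s in auto)
    then show "hausdorff_content s (f -` B \<inter> V) = 0" using B by simp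
  qed
  ultimately show ?thesis by simp
qed

lemma abs_int_decode_ge: "real n \<le> 2 * \<bar>real_of_int (int_decode n)\<bar>"
proof (cases "even n")
  case True
  then show ?thesis by (auto simp: int_decode_def sum_decode_def)
next
  case False
  then have "int_decode n = - int (n div 2) - 1" by (simp add: int_decode_def sum_decode_def)
  then show ?thesis using False by (auto elim!: oddE)
qed

context exp_cosh_tract
begin

definition trapped :: "real \<Rightarrow> complex set" where
  "trapped R = {z. \<forall>n. R \<le> cmod ((f ^^ n) z)}"

lemma trapped_image:
  assumes "z \<in> trapped R"
  shows "f z \<in> trapped R"
proof -
  have "R \<le> cmod ((f ^^ Suc n) z)" for n using assms unfolding trapped_def by blast
  then show ?thesis unfolding trapped_def funpow_Suc_right by simp
qed

text \<open>
  A point with \<open>\<bar>f z\<bar> \<ge> R > C\<close> lies in the strip, and \<open>\<pi>/2 < 2\<close>.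
\<close>

lemma trapped_strip:
  assumes R: "C < R" and z: "z \<in> trapped R"
  shows "\<bar>Im z\<bar> \<le> pi / 2" "R - 2 \<le> \<bar>Re z\<bar>"
proof -
  have 0: "R \<le> cmod z" and 1: "R \<le> cmod (f z)"
    using z unfolding trapped_def by (auto dest: spec[of _ 0] spec[of _ 1])
  show im: "\<bar>Im z\<bar> \<le> pi / 2" using outside[of z] 1 R by force
  show "R - 2 \<le> \<bar>Re z\<bar>" using 0 im cmod_le[of z] pi_less_4 by linarith
qed

text \<open>
  \<open>\<sigma> = \<plusminus>1\<close> selects the half-strip. The integers are enumerated by \<open>int_decode\<close>, so that sums
  over them are series over the naturals; this costs a factor 2 by \<open>abs_int_decode_ge\<close>.
\<close>

definition piece :: "real \<Rightarrow> real \<Rightarrow> nat \<Rightarrow> complex set" where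
  "piece R \<sigma> n = {z \<in> trapped R. 0 \<le> \<sigma> * Re z \<and> \<bar>Im (cosh z) - pi * int_decode n\<bar> \<le> pi / 2}"

definition unit_column :: "real \<Rightarrow> nat \<Rightarrow> complex set" where
  "unit_column R i = {z \<in> trapped R. \<lfloor>Re z\<rfloor> = int_decode i}"

lemma trapped_eq_pieces: "trapped R = (\<Union>n. piece R 1 n) \<union> (\<Union>n. piece R (-1) n)"
proof
  show "trapped R \<subseteq> (\<Union>n. piece R 1 n) \<union> (\<Union>n. piece R (-1) n)"
  proof
    fix z assume z: "z \<in> trapped R"
    define x where "x = Im (cosh z) / pi"
    define n where "n = int_encode (round x)"
    have "\<bar>of_int (round x) - x\<bar> \<le> 1 / 2" by (rule of_int_round_abs_le)
    then have "pi * \<bar>of_int (round x) - x\<bar> \<le> pi * (1 / 2)" by (intro mult_left_mono) auto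
    then have "\<bar>pi * (of_int (round x) - x)\<bar> \<le> pi / 2" by (simp add: abs_mult)
    moreover have "pi * (of_int (round x) - x) = pi * int_decode n - Im (cosh z)"
      by (simp add: n_def x_def algebra_simps)
    ultimately have "\<bar>Im (cosh z) - pi * int_decode n\<bar> \<le> pi / 2" by linarith
    then have "z \<in> piece R 1 n \<or> z \<in> piece R (-1) n" using z by (auto simp: piece_def)
    then show "z \<in> (\<Union>n. piece R 1 n) \<union> (\<Union>n. piece R (-1) n)" by blast
  qed
qed (auto simp: piece_def)

lemma hausdorff_content_piece_le:
  assumes A: "A \<subseteq> piece R \<sigma> n" and \<sigma>: "\<sigma> \<in> {1, -1}" and R: "C < R" and fA: "f ` A \<subseteq> B"
    and m: "18 * C \<le> m" "\<And>u. u \<in> B \<Longrightarrow> m \<le> \<bar>Re u\<bar>" and s: "0 \<le> s"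
  shows "hausdorff_content s A \<le> ennreal ((32 / (m * (real n + 1))) powr s) * hausdorff_content s B"
proof (rule hausdorff_content_le_expansion[OF _ fA _ s])
  have m0: "0 < m" using m(1) C_ge_1 by linarith
  then show "0 < 32 / (m * (real n + 1))" by (simp add: add_nonneg_pos)
  fix z w assume zw: "z \<in> A" "w \<in> A"
  then have T: "z \<in> trapped R" "w \<in> trapped R" using A by (auto simp: piece_def)
  let ?k = "int_decode n"
  have "cmod (z - w) \<le> 16 / ((1 + \<bar>?k\<bar>) * m) * cmod (f z - f w)"
  proof (rule expansion)
    show "m \<le> \<bar>Re (f z)\<bar>" "m \<le> \<bar>Re (f w)\<bar>" using fA m(2) zw by auto
    show "0 \<le> Re z \<and> 0 \<le> Re w \<or> Re z \<le> 0 \<and> Re w \<le> 0"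
      using zw A \<sigma> by (fastforce simp: piece_def)
  qed (use zw A m trapped_strip(1)[OF R] in \<open>auto simp: piece_def\<close>)
  also have "\<dots> \<le> 32 / (m * (real n + 1)) * cmod (f z - f w)"
  proof (intro mult_right_mono)
    have "m * (real n + 1) \<le> m * (2 * (1 + \<bar>real_of_int ?k\<bar>))"
      using abs_int_decode_ge[of n] m0 by (intro mult_left_mono) auto
    then have "32 / (m * (2 * (1 + \<bar>real_of_int ?k\<bar>))) \<le> 32 / (m * (real n + 1))"
      using m0 by (intro divide_left_mono) (auto intro!: mult_pos_pos add_nonneg_pos)
    also have "32 / (m * (2 * (1 + \<bar>real_of_int ?k\<bar>))) = 32 / (2 * ((1 + \<bar>?k\<bar>) * m))"
      by (simp only: mult_ac of_int_add of_int_abs of_int_1)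
    also have "\<dots> = 16 / ((1 + \<bar>?k\<bar>) * m)" by simp
    finally show "16 / ((1 + \<bar>?k\<bar>) * m) \<le> 32 / (m * (real n + 1))" .
  qed auto
  finally show "dist z w \<le> 32 / (m * (real n + 1)) * dist (f z) (f w)" by (simp add: dist_norm)
qed

lemma hausdorff_content_unit_column_le:
  assumes R: "C < R" and s: "0 \<le> s"
  shows "hausdorff_content s (unit_column R i) \<le> ennreal (5 powr s)"
proof -
  have d: "norm (z - w) \<le> 5" if "z \<in> unit_column R i" "w \<in> unit_column R i" for z w
  proof -
    have "\<bar>Re (z - w)\<bar> \<le> 1" using that by (simp add: unit_column_def) linarith
    moreover have "\<bar>Im (z - w)\<bar> \<le> 4"
      using that trapped_strip(1)[OF R, of z] trapped_strip(1)[OF R, of w] pi_less_4 by (auto simp: unit_column_def)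
    ultimately show ?thesis using cmod_le[of "z - w"] by linarith
  qed
  have b: "bounded (unit_column R i)"
    unfolding bounded_def dist_norm using d by (cases "unit_column R i = {}") (blast | metis ex_in_conv)+
  have "hausdorff_content s (unit_column R i) \<le> ennreal (diameter (unit_column R i) powr s)"
    by (rule hausdorff_content_bounded[OF b])
  also have "\<dots> \<le> ennreal (5 powr s)"
    using d by (intro ennreal_leI powr_mono2 s diameter_ge_0 b diameter_le) auto
  finally show ?thesis .
qed

lemma hausdorff_content_trapped_le:
  assumes "\<And>\<sigma> n. \<sigma> \<in> {1, -1} \<Longrightarrow> hausdorff_content s (piece R \<sigma> n) \<le> ennreal ((1 / (real n + 1)) powr s) * K"
  shows "hausdorff_content s (trapped R) \<le> 2 * ((\<Sum>n. ennreal ((1 / (real n + 1)) powr s)) * K)"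
proof -
  have *: "hausdorff_content s (\<Union>n. piece R \<sigma> n) \<le> (\<Sum>n. ennreal ((1 / (real n + 1)) powr s)) * K"
    if "\<sigma> \<in> {1, -1}" for \<sigma>
  proof -
    have "hausdorff_content s (\<Union>n. piece R \<sigma> n) \<le> (\<Sum>n. hausdorff_content s (piece R \<sigma> n))"
      by (rule hausdorff_content_UN_le)
    also have "\<dots> \<le> (\<Sum>n. ennreal ((1 / (real n + 1)) powr s) * K)"
      by (intro suminf_le assms that) auto
    finally show ?thesis by simp
  qed
  have "hausdorff_content s (trapped R)
      \<le> hausdorff_content s (\<Union>n. piece R 1 n) + hausdorff_content s (\<Union>n. piece R (-1) n)"
    by (subst trapped_eq_pieces) (rule hausdorff_content_Un_le)
  also have "\<dots> \<le> (\<Sum>n. ennreal ((1 / (real n + 1)) powr s)) * K + (\<Sum>n. ennreal ((1 / (real n + 1)) powr s)) * K"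
    by (intro add_mono *) auto
  finally show ?thesis by (simp add: mult_2)
qed

text \<open>
  The threshold \<open>m\<close> is chosen so that the contraction factor \<open>2 * \<zeta> * (32 / m) powr s\<close> is at most
  1/2, where \<open>\<zeta>\<close> is the sum of \<open>(n + 1) powr (- s)\<close>. Finiteness of the content
  needs the finer decomposition by columns, where the gain \<open>1 / \<bar>Re u\<bar>\<close> of \<open>expansion\<close> makes the sum over the columns converge.
\<close>

lemma hausdorff_content_trapped_eq_0:
  assumes s: "1 < s"
  shows "\<exists>R. hausdorff_content s (trapped R) = 0"
proof -
  let ?a = "\<lambda>n. (1 / (real n + 1)) powr s"
  have sum: "summable ?a"
  proof -
    have "summable (\<lambda>n. real n powr (- s))" using s by (simp add: summable_real_powr_iff)
    then have "summable (\<lambda>n. real (Suc n) powr (- s))" by (subst summable_Suc_iff)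
    then show ?thesis by (simp add: powr_minus powr_divide inverse_eq_divide add.commute)
  qed
  define \<zeta> where "\<zeta> = suminf ?a"
  have Z: "(\<Sum>n. ennreal (?a n)) = ennreal \<zeta>"
    unfolding \<zeta>_def by (rule suminf_ennreal2[OF _ sum]) simp
  have \<zeta>0: "0 \<le> \<zeta>" unfolding \<zeta>_def by (rule suminf_nonneg[OF sum]) simp
  define m where "m = max (18 * C) (max 32 (128 * \<zeta>))"
  define R where "R = m + 2"
  have m: "18 * C \<le> m" "32 \<le> m" "128 * \<zeta> \<le> m" by (auto simp: m_def)
  have R: "C < R" using m C_ge_1 by (simp add: R_def)
  let ?c = "hausdorff_content s (trapped R)"
  have Re_ge: "m \<le> \<bar>Re u\<bar>" if "u \<in> trapped R" for u
    using trapped_strip(2)[OF R that] by (simp add: R_def)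
  \<comment> \<open>Column \<open>i\<close> has \<open>\<bar>Re u\<bar> \<ge> i / 2 - 1\<close>, which is at least \<open>(i + 1) / 4\<close> unless \<open>i < 5\<close>; the bound by \<open>m\<close> covers these.\<close>
  have column_ge: "max m ((real i + 1) / 4) \<le> \<bar>Re u\<bar>" if "u \<in> unit_column R i" for u i
  proof -
    have u: "m \<le> \<bar>Re u\<bar>" "\<lfloor>Re u\<rfloor> = int_decode i" using that Re_ge by (auto simp: unit_column_def)
    have "real i \<le> 2 * \<bar>real_of_int \<lfloor>Re u\<rfloor>\<bar>" using abs_int_decode_ge[of i] u by simp
    also have "\<dots> \<le> 2 * (\<bar>Re u\<bar> + 1)" by (intro mult_left_mono) linarith+
    finally have "real i \<le> 2 * (\<bar>Re u\<bar> + 1)" .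
    moreover have "32 \<le> \<bar>Re u\<bar>" using u(1) m(2) by (rule order_trans[rotated])
    ultimately have "(real i + 1) / 4 \<le> \<bar>Re u\<bar>" by (simp add: field_simps)
    then show ?thesis using u(1) by simp
  qed
  have split: "ennreal ((L / (real n + 1)) powr s) = ennreal (?a n) * ennreal (L powr s)" if "0 \<le> L" for L n
  proof -
    have "(L / (real n + 1)) powr s = ?a n * L powr s"
      using that by (subst powr_mult[symmetric]) auto
    then show ?thesis by (simp add: ennreal_mult)
  qed
  have finite: "?c < top"
  proof -
    let ?K = "\<Sum>i. ennreal ((128 / (real i + 1)) powr s) * ennreal (5 powr s)"
    have "?c \<le> 2 * ((\<Sum>n. ennreal (?a n)) * ?K)"
    proof (rule hausdorff_content_trapped_le)
      fix \<sigma> :: real and n assume \<sigma>: "\<sigma> \<in> {1, -1}"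
      have "piece R \<sigma> n \<subseteq> (\<Union>i. piece R \<sigma> n \<inter> f -` unit_column R i)"
      proof
        fix z assume z: "z \<in> piece R \<sigma> n"
        then have "f z \<in> unit_column R (int_encode \<lfloor>Re (f z)\<rfloor>)"
          using trapped_image by (simp add: unit_column_def piece_def)
        then show "z \<in> (\<Union>i. piece R \<sigma> n \<inter> f -` unit_column R i)" using z by blast
      qed
      then have "hausdorff_content s (piece R \<sigma> n) \<le> (\<Sum>i. hausdorff_content s (piece R \<sigma> n \<inter> f -` unit_column R i))"
        using hausdorff_content_mono hausdorff_content_UN_le order_trans by blast
      also have "\<dots> \<le> (\<Sum>i. ennreal (?a n) * (ennreal ((128 / (real i + 1)) powr s) * ennreal (5 powr s)))"
      proof (intro suminf_le)
        fix i
        let ?m = "max m ((real i + 1) / 4)"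
        have "hausdorff_content s (piece R \<sigma> n \<inter> f -` unit_column R i)
            \<le> ennreal ((32 / (?m * (real n + 1))) powr s) * hausdorff_content s (unit_column R i)"
          by (rule hausdorff_content_piece_le[OF _ \<sigma> R _ _ column_ge]) (use m s in auto)
        also have "\<dots> \<le> ennreal (((128 / (real i + 1)) / (real n + 1)) powr s) * ennreal (5 powr s)"
        proof (intro mult_mono ennreal_leI powr_mono2 hausdorff_content_unit_column_le[OF R])
          have "32 / (?m * (real n + 1)) \<le> 32 / ((real i + 1) / 4 * (real n + 1))"
            using m(2) by (intro divide_left_mono mult_right_mono) (auto intro!: mult_pos_pos add_nonneg_pos)
          then show "32 / (?m * (real n + 1)) \<le> 128 / (real i + 1) / (real n + 1)" by simp
          show "0 \<le> 32 / (?m * (real n + 1))" using m(2) by simp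
        qed (use s in auto)
        also have "\<dots> = ennreal (?a n) * (ennreal ((128 / (real i + 1)) powr s) * ennreal (5 powr s))"
          by (subst split) (auto simp: mult.assoc)
        finally show "hausdorff_content s (piece R \<sigma> n \<inter> f -` unit_column R i)
            \<le> ennreal (?a n) * (ennreal ((128 / (real i + 1)) powr s) * ennreal (5 powr s))" .
      qed auto
      finally show "hausdorff_content s (piece R \<sigma> n) \<le> ennreal (?a n) * ?K" by simp
    qed
    also have "?K = ennreal \<zeta> * ennreal (128 powr s) * ennreal (5 powr s)"
      unfolding split[of 128, OF zero_le_numeral] ennreal_suminf_multc Z ..
    also have "2 * ((\<Sum>n. ennreal (?a n)) * \<dots>) < top"
      unfolding Z by (simp add: ennreal_mult_less_top)
    finally show ?thesis .
  qed
  have "?c \<le> 2 * ((\<Sum>n. ennreal (?a n)) * (ennreal ((32 / m) powr s) * ?c))"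
  proof (rule hausdorff_content_trapped_le)
    fix \<sigma> :: real and n assume \<sigma>: "\<sigma> \<in> {1, -1}"
    have "hausdorff_content s (piece R \<sigma> n) \<le> ennreal ((32 / (m * (real n + 1))) powr s) * ?c"
      by (rule hausdorff_content_piece_le[OF order_refl \<sigma> R _ m(1) Re_ge])
        (use s trapped_image in \<open>auto simp: piece_def\<close>)
    also have "32 / (m * (real n + 1)) = (32 / m) / (real n + 1)" by simp
    also have "ennreal (\<dots> powr s) * ?c = ennreal (?a n) * (ennreal ((32 / m) powr s) * ?c)"
      using m(2) by (subst split) (auto simp: mult.assoc)
    finally show "hausdorff_content s (piece R \<sigma> n) \<le> ennreal (?a n) * (ennreal ((32 / m) powr s) * ?c)" .
  qed
  also have "\<dots> = ennreal (2 * \<zeta> * (32 / m) powr s) * ?c"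
    unfolding Z using \<zeta>0 by (simp add: ennreal_mult mult.assoc)
  also have "\<dots> \<le> ennreal (1 / 2) * ?c"
  proof (intro mult_right_mono ennreal_leI)
    have "(32 / m) powr s \<le> (32 / m) powr 1" using m(2) s by (intro powr_mono') auto
    then have "2 * \<zeta> * (32 / m) powr s \<le> 2 * \<zeta> * (32 / m)" using \<zeta>0 m(2) by (intro mult_left_mono) auto
    also have "\<dots> \<le> 1 / 2" using m by (simp add: field_simps)
    finally show "2 * \<zeta> * (32 / m) powr s \<le> 1 / 2" .
  qed auto
  finally have half: "?c \<le> ennreal (1 / 2) * ?c" .
  obtain r where r: "?c = ennreal r" "0 \<le> r" using finite by (cases ?c) auto
  have "ennreal (1 / 2) * ennreal r = ennreal (1 / 2 * r)"
    by (rule ennreal_mult[symmetric]) (use r in auto)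
  with half have "ennreal r \<le> ennreal (1 / 2 * r)" unfolding r(1) by (simp only:)
  then have "r \<le> 1 / 2 * r" using r(2) by (subst (asm) ennreal_le_iff) auto
  then have "?c = 0" using r by simp
  then show ?thesis by blast
qed

lemma escaping_set_hausdorff_content_eq_0:
  assumes s: "1 < s"
  shows "hausdorff_content s (escaping_set f) = 0"
proof -
  obtain R where R: "hausdorff_content s (trapped R) = 0" using hausdorff_content_trapped_eq_0[OF s] by blast
  have vim: "hausdorff_content s ((f ^^ N) -` trapped R) = 0" for N
  proof (induction N)
    case (Suc N)
    show ?case unfolding funpow_Suc_right vimage_comp[symmetric]
      using vimage_hausdorff_content_eq_0[OF holo not_constant Suc.IH] s by simp
  qed (use R in simp)
  have "escaping_set f \<subseteq> (\<Union>N\<in>UNIV. (f ^^ N) -` trapped R)"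
  proof
    fix z assume "z \<in> escaping_set f"
    then have "filterlim (\<lambda>n. norm ((f ^^ n) z)) at_top sequentially"
      unfolding escaping_set_def by (auto intro: filterlim_at_infinity_imp_norm_at_top)
    then have "\<forall>\<^sub>F n in sequentially. R \<le> norm ((f ^^ n) z)" unfolding filterlim_at_top by blast
    then obtain N where N: "\<And>n. N \<le> n \<Longrightarrow> R \<le> norm ((f ^^ n) z)" unfolding eventually_sequentially by blast
    have "(f ^^ n) ((f ^^ N) z) = (f ^^ (n + N)) z" for n by (simp add: funpow_add)
    then have "(f ^^ N) z \<in> trapped R" using N by (simp add: trapped_def)
    then show "z \<in> (\<Union>N\<in>UNIV. (f ^^ N) -` trapped R)" by blast
  qed
  then have "hausdorff_content s (escaping_set f) \<le> hausdorff_content s (\<Union>N\<in>UNIV. (f ^^ N) -` trapped R)"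
    by (rule hausdorff_content_mono)
  also have "\<dots> = 0" by (rule hausdorff_content_countable_Union_eq_0) (auto simp: vim)
  finally show ?thesis by simp
qed

lemma escaping_set_dim: "hausdorff_dim (escaping_set f) = 1"
  using hausdorff_dim_le[of 1 "escaping_set f", OF escaping_set_hausdorff_content_eq_0]
    escaping_set_dim_ge_1 by (intro antisym) auto

end

theorem theorem1p1:
  shows "\<exists>f \<in> Eremenko_Lyubich_class. hausdorff_dim (escaping_set f) = 1"
proof -
  obtain f C where "exp_cosh_tract f C" using exp_cosh_tract_exists by blast
  then interpret exp_cosh_tract f C .
  show ?thesis using in_Eremenko_Lyubich_class escaping_set_dim by blast
qed

end
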